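(* Work in ZFC. For any ordinal $\delta$ the following schemes are equivalent (each instance of one being provable from the other scheme): (1) $\mathrm{Val}_{\mathcal{V}}(V_\delta,\mathcal{L}^\Diamond_{\in,V_\delta})=\mathrm{S5}$, i.e. every substitution instance of every S5 theorem by assertions of the potentialist language $\mathcal{L}_\in^\Diamond$ with parameters from $V_\delta$ holds at $V_\delta$ in rank potentialism; (2) $\delta$ is a correct cardinal, i.e. $V_\delta\prec_{\Sigma_n}V$ for every natural number $n$ (the scheme $V_\delta\prec V$).
   Context: $\mathcal{V}=\{V_\beta\mid\beta\in\mathrm{Ord}\}$ is rank potentialism: worlds are the $V_\beta$, $V_\beta$ accesses $V_\gamma$ iff $\beta\le\gamma$; $\Diamond\varphi$ at $V_\beta$ means $\varphi$ holds at some $V_\gamma$, $\gamma\ge\beta$, $\Box\varphi$ at all such; quantifiers range over the current world. $\mathcal{L}_\in^\Diamond$ is the language of set theory augmented with $\Diamond,\Box$; the subscript $V_\delta$ allows parameters from $V_\delta$. $\mathrm{Val}_{\mathcal{V}}(W,\mathcal{L}')$ is the set of propositional modal formulas all of whose substitution instances by $\mathcal{L}'$-assertions are true at $W$. Since neither condition is a single first-order statement, the equivalence is a pair of theorem schemes. *)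

theory Defs
  imports Main
begin

section \<open>First-order set theory\<close>

text \<open>Variables are de Bruijn indices. The language has no function symbols, so every term is a
  variable and substitution is renaming of variables.\<close>

datatype fm =
    Mem nat nat  (infix \<open>\<^bold>\<in>\<close> 80)
  | Eq nat nat   (infix \<open>\<^bold>=\<close> 80)
  | Fls          (\<open>\<^bold>\<bottom>\<close>)
  | Imp fm fm    (infixr \<open>\<^bold>\<longrightarrow>\<close> 70)
  | All fm       (\<open>\<^bold>\<forall>_\<close> [75] 75)

abbreviation Neg :: "fm \<Rightarrow> fm" (\<open>\<^bold>\<not>_\<close> [75] 75) where
  "\<^bold>\<not>\<phi> \<equiv> \<phi> \<^bold>\<longrightarrow> \<^bold>\<bottom>"

abbreviation Con :: "fm \<Rightarrow> fm \<Rightarrow> fm" (infixr \<open>\<^bold>\<and>\<close> 73) where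
  "\<phi> \<^bold>\<and> \<psi> \<equiv> \<^bold>\<not>(\<phi> \<^bold>\<longrightarrow> \<^bold>\<not>\<psi>)"

abbreviation Dis :: "fm \<Rightarrow> fm \<Rightarrow> fm" (infixr \<open>\<^bold>\<or>\<close> 72) where
  "\<phi> \<^bold>\<or> \<psi> \<equiv> \<^bold>\<not>\<phi> \<^bold>\<longrightarrow> \<psi>"

abbreviation Iff :: "fm \<Rightarrow> fm \<Rightarrow> fm" (infix \<open>\<^bold>\<longleftrightarrow>\<close> 69) where
  "\<phi> \<^bold>\<longleftrightarrow> \<psi> \<equiv> (\<phi> \<^bold>\<longrightarrow> \<psi>) \<^bold>\<and> (\<psi> \<^bold>\<longrightarrow> \<phi>)"

abbreviation Exi :: "fm \<Rightarrow> fm" (\<open>\<^bold>\<exists>_\<close> [75] 75) where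
  "\<^bold>\<exists>\<phi> \<equiv> \<^bold>\<not>(\<^bold>\<forall>(\<^bold>\<not>\<phi>))"

primrec fv :: "fm \<Rightarrow> nat set" where
  "fv (x \<^bold>\<in> y) = {x, y}"
| "fv (x \<^bold>= y) = {x, y}"
| "fv \<^bold>\<bottom> = {}"
| "fv (\<phi> \<^bold>\<longrightarrow> \<psi>) = fv \<phi> \<union> fv \<psi>"
| "fv (\<^bold>\<forall>\<phi>) = {i. Suc i \<in> fv \<phi>}"

primrec rename :: "(nat \<Rightarrow> nat) \<Rightarrow> fm \<Rightarrow> fm" where
  "rename r (x \<^bold>\<in> y) = (r x \<^bold>\<in> r y)"
| "rename r (x \<^bold>= y) = (r x \<^bold>= r y)"
| "rename r \<^bold>\<bottom> = \<^bold>\<bottom>"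
| "rename r (\<phi> \<^bold>\<longrightarrow> \<psi>) = (rename r \<phi> \<^bold>\<longrightarrow> rename r \<psi>)"
| "rename r (\<^bold>\<forall>\<phi>) = \<^bold>\<forall>(rename (case_nat 0 (\<lambda>i. Suc (r i))) \<phi>)"

definition inst :: "nat \<Rightarrow> fm \<Rightarrow> fm" where
  "inst t \<phi> = rename (case_nat t (\<lambda>i. i)) \<phi>"

text \<open>Classical natural deduction with equality. Free variables of the assumptions act as
  constants: rule \<open>AllI\<close> frees index 0 by shifting all assumptions.\<close>

inductive deriv :: "fm set \<Rightarrow> fm \<Rightarrow> bool" (infix \<open>\<turnstile>\<close> 50) where
  Assm: "\<phi> \<in> \<Gamma> \<Longrightarrow> \<Gamma> \<turnstile> \<phi>"
| ImpI: "insert \<phi> \<Gamma> \<turnstile> \<psi> \<Longrightarrow> \<Gamma> \<turnstile> \<phi> \<^bold>\<longrightarrow> \<psi>"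
| ImpE: "\<Gamma> \<turnstile> \<phi> \<^bold>\<longrightarrow> \<psi> \<Longrightarrow> \<Gamma> \<turnstile> \<phi> \<Longrightarrow> \<Gamma> \<turnstile> \<psi>"
| Contr: "insert (\<^bold>\<not>\<phi>) \<Gamma> \<turnstile> \<^bold>\<bottom> \<Longrightarrow> \<Gamma> \<turnstile> \<phi>"
| AllI: "rename Suc ` \<Gamma> \<turnstile> \<phi> \<Longrightarrow> \<Gamma> \<turnstile> \<^bold>\<forall>\<phi>"
| AllE: "\<Gamma> \<turnstile> \<^bold>\<forall>\<phi> \<Longrightarrow> \<Gamma> \<turnstile> inst t \<phi>"
| EqRefl: "\<Gamma> \<turnstile> x \<^bold>= x"
| EqSubst: "\<Gamma> \<turnstile> x \<^bold>= y \<Longrightarrow> \<Gamma> \<turnstile> inst x \<phi> \<Longrightarrow> \<Gamma> \<turnstile> inst y \<phi>"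


section \<open>The axioms of ZFC\<close>

definition subset_fm :: "nat \<Rightarrow> nat \<Rightarrow> fm" where
  "subset_fm x y = \<^bold>\<forall>(0 \<^bold>\<in> Suc x \<^bold>\<longrightarrow> 0 \<^bold>\<in> Suc y)"

text \<open>\<open>s = x \<union> {x}\<close>\<close>

definition succ_fm :: "nat \<Rightarrow> nat \<Rightarrow> fm" where
  "succ_fm s x = \<^bold>\<forall>(0 \<^bold>\<in> Suc s \<^bold>\<longleftrightarrow> 0 \<^bold>\<in> Suc x \<^bold>\<or> 0 \<^bold>= Suc x)"

definition extensionality :: fm where
  "extensionality = \<^bold>\<forall>(\<^bold>\<forall>(\<^bold>\<forall>(0 \<^bold>\<in> 2 \<^bold>\<longleftrightarrow> 0 \<^bold>\<in> 1) \<^bold>\<longrightarrow> 1 \<^bold>= 0))"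

definition foundation :: fm where
  "foundation = \<^bold>\<forall>(\<^bold>\<exists>(0 \<^bold>\<in> 1) \<^bold>\<longrightarrow> \<^bold>\<exists>(0 \<^bold>\<in> 1 \<^bold>\<and> \<^bold>\<not>\<^bold>\<exists>(0 \<^bold>\<in> 1 \<^bold>\<and> 0 \<^bold>\<in> 2)))"

definition pairing :: fm where
  "pairing = \<^bold>\<forall>(\<^bold>\<forall>(\<^bold>\<exists>(\<^bold>\<forall>(0 \<^bold>\<in> 1 \<^bold>\<longleftrightarrow> 0 \<^bold>= 3 \<^bold>\<or> 0 \<^bold>= 2))))"

definition union_ax :: fm where
  "union_ax = \<^bold>\<forall>(\<^bold>\<exists>(\<^bold>\<forall>(0 \<^bold>\<in> 1 \<^bold>\<longleftrightarrow> \<^bold>\<exists>(0 \<^bold>\<in> 3 \<^bold>\<and> 1 \<^bold>\<in> 0))))"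

definition powerset :: fm where
  "powerset = \<^bold>\<forall>(\<^bold>\<exists>(\<^bold>\<forall>(0 \<^bold>\<in> 1 \<^bold>\<longleftrightarrow> subset_fm 0 2)))"

definition infinity :: fm where
  "infinity = \<^bold>\<exists>(\<^bold>\<exists>(0 \<^bold>\<in> 1 \<^bold>\<and> \<^bold>\<not>\<^bold>\<exists>(0 \<^bold>\<in> 1)) \<^bold>\<and>
                \<^bold>\<forall>(0 \<^bold>\<in> 1 \<^bold>\<longrightarrow> \<^bold>\<exists>(0 \<^bold>\<in> 2 \<^bold>\<and> succ_fm 0 1)))"

text \<open>Every family of nonempty pairwise disjoint sets has a selector.\<close>

definition choice :: fm where
  "choice = \<^bold>\<forall>(\<^bold>\<forall>(0 \<^bold>\<in> 1 \<^bold>\<longrightarrow> \<^bold>\<exists>(0 \<^bold>\<in> 1)) \<^bold>\<and>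
               \<^bold>\<forall>(\<^bold>\<forall>(1 \<^bold>\<in> 2 \<^bold>\<and> 0 \<^bold>\<in> 2 \<^bold>\<and> \<^bold>\<exists>(0 \<^bold>\<in> 2 \<^bold>\<and> 0 \<^bold>\<in> 1) \<^bold>\<longrightarrow> 1 \<^bold>= 0))
              \<^bold>\<longrightarrow> \<^bold>\<exists>(\<^bold>\<forall>(0 \<^bold>\<in> 2 \<^bold>\<longrightarrow> \<^bold>\<exists>(\<^bold>\<forall>(0 \<^bold>\<in> 2 \<^bold>\<and> 0 \<^bold>\<in> 3 \<^bold>\<longleftrightarrow> 0 \<^bold>= 1)))))"

text \<open>Separation: \<open>\<forall>a. \<exists>b. \<forall>z. z \<in> b \<longleftrightarrow> z \<in> a \<and> \<phi>(z, a, \<dots>)\<close>, with \<open>z\<close> the variable 0 of \<open>\<phi>\<close>,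
  \<open>a\<close> its variable 1, and parameters from 2 on.\<close>

definition separation :: "fm \<Rightarrow> fm" where
  "separation \<phi> = \<^bold>\<forall>(\<^bold>\<exists>(\<^bold>\<forall>(0 \<^bold>\<in> 1 \<^bold>\<longleftrightarrow> 0 \<^bold>\<in> 2 \<^bold>\<and> rename (case_nat 0 (\<lambda>i. i + 2)) \<phi>)))"

text \<open>Replacement: if \<open>\<phi>(y, x, a, \<dots>)\<close> is functional in \<open>x \<in> a\<close>, then the image of \<open>a\<close> is a set.
  Here \<open>y\<close> is the variable 0 of \<open>\<phi>\<close>, \<open>x\<close> its variable 1, \<open>a\<close> its variable 2, and parameters
  follow from 3 on.\<close>

definition replacement :: "fm \<Rightarrow> fm" where
  "replacement \<phi> = \<^bold>\<forall>(
     \<^bold>\<forall>(0 \<^bold>\<in> 1 \<^bold>\<longrightarrow> \<^bold>\<forall>(\<^bold>\<forall>(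
        rename Suc \<phi> \<^bold>\<and> rename (case_nat 0 (\<lambda>i. i + 2)) \<phi> \<^bold>\<longrightarrow> 1 \<^bold>= 0)))
     \<^bold>\<longrightarrow> \<^bold>\<exists>(\<^bold>\<forall>(0 \<^bold>\<in> 1 \<^bold>\<longleftrightarrow>
        \<^bold>\<exists>(0 \<^bold>\<in> 3 \<^bold>\<and> rename (case_nat 1 (case_nat 0 (\<lambda>i. i + 3))) \<phi>))))"

text \<open>Schema instances enter through their universal closures, so all axioms are sentences.\<close>

definition ZFC :: "fm set" where
  "ZFC = {extensionality, foundation, pairing, union_ax, powerset, infinity, choice}
     \<union> {\<psi>. fv \<psi> = {} \<and> (\<exists>n \<phi>. \<psi> = (All ^^ n) (separation \<phi>))}
     \<union> {\<psi>. fv \<psi> = {} \<and> (\<exists>n \<phi>. \<psi> = (All ^^ n) (replacement \<phi>))}"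


section \<open>The cumulative hierarchy\<close>

definition transitive_fm :: "nat \<Rightarrow> fm" where
  "transitive_fm x = \<^bold>\<forall>(0 \<^bold>\<in> Suc x \<^bold>\<longrightarrow> subset_fm 0 (Suc x))"

text \<open>In the presence of Foundation, ordinals are the transitive sets of transitive sets.\<close>

definition ord_fm :: "nat \<Rightarrow> fm" where
  "ord_fm x = transitive_fm x \<^bold>\<and> \<^bold>\<forall>(0 \<^bold>\<in> Suc x \<^bold>\<longrightarrow> transitive_fm 0)"

text \<open>The order of the ordinals: \<open>x \<in> y \<or> x = y\<close>.\<close>

definition le_fm :: "nat \<Rightarrow> nat \<Rightarrow> fm" where
  "le_fm x y = x \<^bold>\<in> y \<^bold>\<or> x \<^bold>= y"

text \<open>\<open>z = {x, y}\<close>\<close>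

definition upair_fm :: "nat \<Rightarrow> nat \<Rightarrow> nat \<Rightarrow> fm" where
  "upair_fm z x y = \<^bold>\<forall>(0 \<^bold>\<in> Suc z \<^bold>\<longleftrightarrow> 0 \<^bold>= Suc x \<^bold>\<or> 0 \<^bold>= Suc y)"

text \<open>\<open>p = {{x}, {x, y}}\<close>\<close>

definition pair_fm :: "nat \<Rightarrow> nat \<Rightarrow> nat \<Rightarrow> fm" where
  "pair_fm p x y =
     \<^bold>\<forall>(0 \<^bold>\<in> Suc p \<^bold>\<longleftrightarrow> upair_fm 0 (Suc x) (Suc x) \<^bold>\<or> upair_fm 0 (Suc x) (Suc y))"

text \<open>\<open>(x, y) \<in> f\<close>\<close>

definition app_fm :: "nat \<Rightarrow> nat \<Rightarrow> nat \<Rightarrow> fm" where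
  "app_fm f x y = \<^bold>\<exists>(pair_fm 0 (Suc x) (Suc y) \<^bold>\<and> 0 \<^bold>\<in> Suc f)"

text \<open>\<open>f\<close> is a function with domain \<open>d\<close>.\<close>

definition function_fm :: "nat \<Rightarrow> nat \<Rightarrow> fm" where
  "function_fm f d =
     \<^bold>\<forall>(0 \<^bold>\<in> Suc f \<^bold>\<longrightarrow> \<^bold>\<exists>(0 \<^bold>\<in> (d + 2) \<^bold>\<and> \<^bold>\<exists>(pair_fm 2 1 0))) \<^bold>\<and>
     \<^bold>\<forall>(0 \<^bold>\<in> Suc d \<^bold>\<longrightarrow> \<^bold>\<exists>(\<^bold>\<forall>(app_fm (f + 3) 2 0 \<^bold>\<longleftrightarrow> 0 \<^bold>= 1)))"

text \<open>The recursion \<open>V\<^sub>\<alpha> = (\<Union>\<eta><\<alpha>. Pow V\<^sub>\<eta>)\<close>: \<open>f\<close> is a function with domain \<open>d\<close> and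
  \<open>\<forall>z. z \<in> f(\<alpha>) \<longleftrightarrow> (\<exists>\<eta>\<in>\<alpha>. z \<subseteq> f(\<eta>))\<close> for all \<open>\<alpha> \<in> d\<close>. In the second conjunct the
  bound variables are, from the outside, \<open>\<alpha>\<close>, \<open>v = f(\<alpha>)\<close>, \<open>z\<close>, \<open>\<eta>\<close>, \<open>u = f(\<eta>)\<close>.\<close>

definition hierarchy_fm :: "nat \<Rightarrow> nat \<Rightarrow> fm" where
  "hierarchy_fm f d =
     function_fm f d \<^bold>\<and>
     \<^bold>\<forall>(0 \<^bold>\<in> Suc d \<^bold>\<longrightarrow> \<^bold>\<forall>(app_fm (f + 2) 1 0 \<^bold>\<longrightarrow>
       \<^bold>\<forall>(0 \<^bold>\<in> 1 \<^bold>\<longleftrightarrow> \<^bold>\<exists>(0 \<^bold>\<in> 3 \<^bold>\<and> \<^bold>\<exists>(app_fm (f + 5) 1 0 \<^bold>\<and> subset_fm 2 0)))))"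

text \<open>\<open>v = V\<^sub>b\<close>, the value at \<open>b\<close> of the hierarchy on \<open>b \<union> {b}\<close>\<close>

definition V_fm :: "nat \<Rightarrow> nat \<Rightarrow> fm" where
  "V_fm v b = \<^bold>\<exists>(succ_fm 0 (Suc b) \<^bold>\<and> \<^bold>\<exists>(hierarchy_fm 0 1 \<^bold>\<and> app_fm 0 (b + 2) (v + 2)))"

text \<open>\<open>x \<in> V\<^sub>b\<close>\<close>

definition in_V_fm :: "nat \<Rightarrow> nat \<Rightarrow> fm" where
  "in_V_fm x b = \<^bold>\<exists>(V_fm 0 (Suc b) \<^bold>\<and> Suc x \<^bold>\<in> 0)"

text \<open>\<open>params_in_V k d \<phi>\<close> says that \<open>\<phi>\<close> holds for all values in \<open>V\<^sub>d\<close> of its variables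
  \<open>0, \<dots>, k - 1\<close>; inside \<open>\<phi>\<close> the variable \<open>d\<close> has become \<open>d + k\<close>.\<close>

primrec params_in_V :: "nat \<Rightarrow> nat \<Rightarrow> fm \<Rightarrow> fm" where
  "params_in_V 0 d \<phi> = \<phi>"
| "params_in_V (Suc k) d \<phi> = \<^bold>\<forall>(in_V_fm 0 (Suc d) \<^bold>\<longrightarrow> params_in_V k (Suc d) \<phi>)"


section \<open>Correct cardinals\<close>

inductive Delta0 :: "fm \<Rightarrow> bool" where
  "Delta0 (x \<^bold>\<in> y)"
| "Delta0 (x \<^bold>= y)"
| "Delta0 \<^bold>\<bottom>"
| "Delta0 \<phi> \<Longrightarrow> Delta0 \<psi> \<Longrightarrow> Delta0 (\<phi> \<^bold>\<longrightarrow> \<psi>)"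
| "Delta0 \<phi> \<Longrightarrow> Delta0 (\<^bold>\<forall>(0 \<^bold>\<in> Suc y \<^bold>\<longrightarrow> \<phi>))"
| "Delta0 \<phi> \<Longrightarrow> Delta0 (\<^bold>\<exists>(0 \<^bold>\<in> Suc y \<^bold>\<and> \<phi>))"

text \<open>The Levy hierarchy: at most \<open>n\<close> alternating blocks of unbounded quantifiers in front of a
  \<open>\<Delta>\<^sub>0\<close> formula.\<close>

inductive Levy_Sigma :: "nat \<Rightarrow> fm \<Rightarrow> bool" and Levy_Pi :: "nat \<Rightarrow> fm \<Rightarrow> bool" where
  "Delta0 \<phi> \<Longrightarrow> Levy_Sigma 0 \<phi>"
| "Delta0 \<phi> \<Longrightarrow> Levy_Pi 0 \<phi>"
| "Levy_Pi n \<phi> \<Longrightarrow> Levy_Sigma (Suc n) \<phi>"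
| "Levy_Sigma n \<phi> \<Longrightarrow> Levy_Pi (Suc n) \<phi>"
| "Levy_Sigma (Suc n) \<phi> \<Longrightarrow> Levy_Sigma (Suc n) (\<^bold>\<exists>\<phi>)"
| "Levy_Pi (Suc n) \<phi> \<Longrightarrow> Levy_Pi (Suc n) (\<^bold>\<forall>\<phi>)"

text \<open>\<open>V\<^sub>d \<Turnstile> \<phi>\<close>, as the relativization of \<open>\<phi>\<close> to \<open>V\<^sub>d\<close>\<close>

primrec relativize :: "fm \<Rightarrow> nat \<Rightarrow> fm" where
  "relativize (x \<^bold>\<in> y) d = (x \<^bold>\<in> y)"
| "relativize (x \<^bold>= y) d = (x \<^bold>= y)"
| "relativize \<^bold>\<bottom> d = \<^bold>\<bottom>"
| "relativize (\<phi> \<^bold>\<longrightarrow> \<psi>) d = (relativize \<phi> d \<^bold>\<longrightarrow> relativize \<psi> d)"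
| "relativize (\<^bold>\<forall>\<phi>) d = \<^bold>\<forall>(in_V_fm 0 (Suc d) \<^bold>\<longrightarrow> relativize \<phi> (Suc d))"

text \<open>From here on the ordinal \<open>\<delta>\<close> is the free variable 0.

  \<open>V\<^sub>\<delta> \<prec>\<^bsub>\<Sigma>n\<^esub> V\<close>: the formulas \<open>\<forall>a\<^sub>0 \<dots> a\<^bsub>k-1\<^esub> \<in> V\<^sub>\<delta>. \<phi>(a) \<longleftrightarrow> (V\<^sub>\<delta> \<Turnstile> \<phi>(a))\<close> for \<open>\<phi>\<close> in \<open>\<Sigma>\<^sub>n\<close>.\<close>

definition elementary_scheme :: "nat \<Rightarrow> fm set" where
  "elementary_scheme n =
     {params_in_V k 0 (\<phi> \<^bold>\<longleftrightarrow> relativize \<phi> k) | k \<phi>. Levy_Sigma n \<phi> \<and> fv \<phi> \<subseteq> {..<k}}"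

definition correct_scheme :: "fm set" where
  "correct_scheme = (\<Union>n. elementary_scheme n)"


section \<open>Rank potentialism\<close>

text \<open>The potentialist language: set theory with modal operators.\<close>

datatype mfm = MMem nat nat | MEq nat nat | MFls | MImp mfm mfm | MAll mfm | MBox mfm

abbreviation MDia :: "mfm \<Rightarrow> mfm" where
  "MDia \<phi> \<equiv> MImp (MBox (MImp \<phi> MFls)) MFls"

primrec mfv :: "mfm \<Rightarrow> nat set" where
  "mfv (MMem x y) = {x, y}"
| "mfv (MEq x y) = {x, y}"
| "mfv MFls = {}"
| "mfv (MImp \<phi> \<psi>) = mfv \<phi> \<union> mfv \<psi>"
| "mfv (MAll \<phi>) = {i. Suc i \<in> mfv \<phi>}"
| "mfv (MBox \<phi>) = mfv \<phi>"

text \<open>\<open>true_at \<phi> e w\<close> expresses in the language of set theory that \<open>\<phi>\<close> is true at the world \<open>V\<^sub>w\<close>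
  of rank potentialism, where the free variable \<open>i\<close> of \<open>\<phi>\<close> is represented by the variable \<open>e i\<close>.
  The new variable bound in the modal clause is the index \<open>\<gamma> \<ge> w\<close> of the accessed world.\<close>

primrec true_at :: "mfm \<Rightarrow> (nat \<Rightarrow> nat) \<Rightarrow> nat \<Rightarrow> fm" where
  "true_at (MMem x y) e w = (e x \<^bold>\<in> e y)"
| "true_at (MEq x y) e w = (e x \<^bold>= e y)"
| "true_at MFls e w = \<^bold>\<bottom>"
| "true_at (MImp \<phi> \<psi>) e w = (true_at \<phi> e w \<^bold>\<longrightarrow> true_at \<psi> e w)"
| "true_at (MAll \<phi>) e w =
     \<^bold>\<forall>(in_V_fm 0 (Suc w) \<^bold>\<longrightarrow> true_at \<phi> (case_nat 0 (\<lambda>i. Suc (e i))) (Suc w))"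
| "true_at (MBox \<phi>) e w =
     \<^bold>\<forall>(ord_fm 0 \<^bold>\<and> le_fm (Suc w) 0 \<^bold>\<longrightarrow> true_at \<phi> (\<lambda>i. Suc (e i)) 0)"

text \<open>\<open>\<psi>(a)\<close> is true at \<open>V\<^sub>\<delta>\<close> for all parameters \<open>a\<^sub>0, \<dots>, a\<^bsub>k-1\<^esub> \<in> V\<^sub>\<delta>\<close>.\<close>

definition true_at_V :: "nat \<Rightarrow> mfm \<Rightarrow> fm" where
  "true_at_V k \<psi> = params_in_V k 0 (true_at \<psi> (\<lambda>i. i) k)"


section \<open>Propositional modal logic\<close>

datatype pm = PAtom nat | PFls | PImp pm pm | PBox pm

abbreviation PNeg :: "pm \<Rightarrow> pm" where
  "PNeg p \<equiv> PImp p PFls"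

abbreviation PDia :: "pm \<Rightarrow> pm" where
  "PDia p \<equiv> PNeg (PBox (PNeg p))"

inductive_set S5 :: "pm set" where
  A1: "PImp p (PImp q p) \<in> S5"
| A2: "PImp (PImp p (PImp q r)) (PImp (PImp p q) (PImp p r)) \<in> S5"
| A3: "PImp (PNeg (PNeg p)) p \<in> S5"
| K: "PImp (PBox (PImp p q)) (PImp (PBox p) (PBox q)) \<in> S5"
| T: "PImp (PBox p) p \<in> S5"
| Five: "PImp (PDia p) (PBox (PDia p)) \<in> S5"
| MP: "PImp p q \<in> S5 \<Longrightarrow> p \<in> S5 \<Longrightarrow> q \<in> S5"
| Nec: "p \<in> S5 \<Longrightarrow> PBox p \<in> S5"

primrec psubst :: "(nat \<Rightarrow> mfm) \<Rightarrow> pm \<Rightarrow> mfm" where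
  "psubst \<sigma> (PAtom i) = \<sigma> i"
| "psubst \<sigma> PFls = MFls"
| "psubst \<sigma> (PImp p q) = MImp (psubst \<sigma> p) (psubst \<sigma> q)"
| "psubst \<sigma> (PBox p) = MBox (psubst \<sigma> p)"

text \<open>The assertions that the substitution instances of \<open>p\<close> hold at \<open>V\<^sub>\<delta>\<close> with parameters from
  \<open>V\<^sub>\<delta>\<close>. Together they express that \<open>p\<close> is a potentialist validity at \<open>V\<^sub>\<delta>\<close>.\<close>

definition validity_scheme :: "pm \<Rightarrow> fm set" where
  "validity_scheme p = {true_at_V k (psubst \<sigma> p) | k \<sigma>. mfv (psubst \<sigma> p) \<subseteq> {..<k}}"

definition S5_scheme :: "fm set" where
  "S5_scheme = (\<Union>p\<in>S5. validity_scheme p)"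

definition ZFC_ord :: "fm set" where
  "ZFC_ord = insert (ord_fm 0) ZFC"

end

theory Submission
  imports Defs "HOL-Library.Countable_Set"
begin

text \<open>By the completeness theorem, derivability from ZFC may be checked in all countable models of
  ZFC. Inside such a model let \<open>\<delta>\<close> be the given ordinal.

  If \<open>V\<^sub>\<delta> \<prec> V\<close>, then a potentialist assertion with parameters in \<open>V\<^sub>\<delta>\<close> that holds at some world
  above \<open>V\<^sub>\<delta>\<close> holds at unboundedly many worlds. So the axiom 5 holds at all worlds above \<open>V\<^sub>\<delta>\<close>, and S5 is
  valid. A modal formula outside S5 fails in a finite universal frame with worlds \<open>0, \<dots>, n\<close>, at the
  world \<open>0\<close> say. The world \<open>V\<^bsub>\<delta>+j\<^esub>\<close> can be recognized from inside as lying \<open>j\<close> steps above a limit, so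
  the distance to the next limit below, capped at \<open>n\<close>, is a dial that shows \<open>0\<close> at \<open>V\<^sub>\<delta>\<close> and takes
  every value at unboundedly many worlds. It carries the valuation of the frame to an instance that
  fails at \<open>V\<^sub>\<delta>\<close>.

  Conversely, replacing \<open>\<forall>\<close> by \<open>\<box>\<forall>\<close> turns truth in \<open>V\<close> into truth at any world. If
  \<open>\<exists>x. \<phi>(x, a)\<close> holds in \<open>V\<close>, then \<open>\<exists>x. \<phi>\<^sup>\<diamond>(x, a)\<close> is possibly necessary at \<open>V\<^sub>\<delta>\<close>, hence true there
  by S5. This is the Tarski--Vaught criterion for \<open>V\<^sub>\<delta> \<prec> V\<close>.\<close>

section \<open>Completeness of the deduction system\<close>

lemma rename_cong: "(\<And>i. i \<in> fv \<phi> \<Longrightarrow> r i = r' i) \<Longrightarrow> rename r \<phi> = rename r' \<phi>"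
proof (induction \<phi> arbitrary: r r')
  case (All \<phi>)
  have "rename (case_nat 0 (\<lambda>i. Suc (r i))) \<phi> = rename (case_nat 0 (\<lambda>i. Suc (r' i))) \<phi>"
    using All.prems by (intro All.IH) (auto split: nat.split)
  then show ?case by simp
next
  case (Imp \<phi> \<psi>)
  then show ?case by (metis UnCI fv.simps(4) rename.simps(4))
qed auto

lemma rename_rename: "rename r (rename q \<phi>) = rename (\<lambda>i. r (q i)) \<phi>"
proof (induction \<phi> arbitrary: r q)
  case (All \<phi>)
  have "(\<lambda>i. case_nat 0 (\<lambda>i. Suc (r i)) (case_nat 0 (\<lambda>i. Suc (q i)) i))
      = case_nat 0 (\<lambda>i. Suc (r (q i)))"
    by (auto split: nat.split)
  then show ?case using All by simp
qed auto

lemma rename_ident: "rename (\<lambda>i. i) \<phi> = \<phi>"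
proof (induction \<phi>)
  case (All \<phi>)
  have "case_nat 0 (\<lambda>i. Suc i) = (\<lambda>i. i)" by (auto split: nat.split)
  then show ?case using All by simp
qed auto

lemma fv_rename: "fv (rename r \<phi>) = r ` fv \<phi>"
proof (induction \<phi> arbitrary: r)
  case (All \<phi>)
  show ?case
  proof (intro set_eqI iffI)
    fix i assume "i \<in> fv (rename r (\<^bold>\<forall>\<phi>))"
    then obtain j where "j \<in> fv \<phi>" "Suc i = case_nat 0 (\<lambda>i. Suc (r i)) j"
      using All by auto
    then show "i \<in> r ` fv (\<^bold>\<forall>\<phi>)" by (cases j) auto
  next
    fix i assume "i \<in> r ` fv (\<^bold>\<forall>\<phi>)"
    then obtain j where "Suc j \<in> fv \<phi>" "i = r j" by auto
    then show "i \<in> fv (rename r (\<^bold>\<forall>\<phi>))"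
      using All by (auto intro!: image_eqI[where x = "Suc j"])
  qed
qed auto

lemma finite_fv: "finite (fv \<phi>)"
proof (induction \<phi>)
  case (All \<phi>)
  have "fv (\<^bold>\<forall>\<phi>) \<subseteq> (\<lambda>i. i - 1) ` fv \<phi>"
    by (auto intro!: image_eqI[where x = "Suc _"])
  then show ?case using All finite_surj by blast
qed auto

lemma rename_inst: "rename r (inst t \<phi>) = inst (r t) (rename (case_nat 0 (\<lambda>i. Suc (r i))) \<phi>)"
  unfolding inst_def rename_rename by (rule rename_cong) (auto split: nat.split)

lemma deriv_mono: "\<Gamma> \<turnstile> \<phi> \<Longrightarrow> \<Gamma> \<subseteq> \<Delta> \<Longrightarrow> \<Delta> \<turnstile> \<phi>"
proof (induction arbitrary: \<Delta> rule: deriv.induct)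
  case (ImpI \<phi> \<Gamma> \<psi>)
  then show ?case by (meson deriv.ImpI insert_mono)
next
  case (Contr \<phi> \<Gamma>)
  then show ?case by (meson deriv.Contr insert_mono)
next
  case (AllI \<Gamma> \<phi>)
  then show ?case by (meson deriv.AllI image_mono)
qed (blast intro: deriv.intros)+

text \<open>The renaming may identify variables: free variables behave like constants, and
  identifying constants preserves derivations. Under \<open>AllI\<close> it continues below the
  binder, where it fixes index 0.\<close>

lemma deriv_rename: "\<Gamma> \<turnstile> \<phi> \<Longrightarrow> rename r ` \<Gamma> \<turnstile> rename r \<phi>"
proof (induction arbitrary: r rule: deriv.induct)
  case (ImpI \<phi> \<Gamma> \<psi>)
  then show ?case by (auto intro: deriv.ImpI)
next
  case (Contr \<phi> \<Gamma>)
  from Contr.IH[of r] show ?case by (auto intro: deriv.Contr)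
next
  case (AllI \<Gamma> \<phi>)
  have "rename (case_nat 0 (\<lambda>i. Suc (r i))) ` rename Suc ` \<Gamma> = rename Suc ` rename r ` \<Gamma>"
    by (simp add: image_image rename_rename)
  then show ?case using AllI.IH[of "case_nat 0 (\<lambda>i. Suc (r i))"] by (auto intro: deriv.AllI)
next
  case (AllE \<Gamma> \<phi> t)
  from AllE.IH[of r] show ?case by (simp add: rename_inst deriv.AllE)
next
  case (EqSubst \<Gamma> x y \<phi>)
  then show ?case by (auto simp: rename_inst intro: deriv.EqSubst)
qed (auto intro: deriv.intros)

lemma deriv_finite: "\<Gamma> \<turnstile> \<phi> \<Longrightarrow> \<exists>\<Delta>\<subseteq>\<Gamma>. finite \<Delta> \<and> \<Delta> \<turnstile> \<phi>"
proof (induction rule: deriv.induct)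
  case (Assm \<phi> \<Gamma>)
  then show ?case by (intro exI[of _ "{\<phi>}"]) (auto intro: deriv.Assm)
next
  case (ImpI \<phi> \<Gamma> \<psi>)
  then obtain \<Delta> where "\<Delta> \<subseteq> insert \<phi> \<Gamma>" "finite \<Delta>" "\<Delta> \<turnstile> \<psi>" by blast
  moreover from \<open>\<Delta> \<turnstile> \<psi>\<close> have "insert \<phi> (\<Delta> - {\<phi>}) \<turnstile> \<psi>" by (rule deriv_mono) blast
  then have "\<Delta> - {\<phi>} \<turnstile> \<phi> \<^bold>\<longrightarrow> \<psi>" by (rule deriv.ImpI)
  ultimately show ?case by (intro exI[of _ "\<Delta> - {\<phi>}"]) auto
next
  case (ImpE \<Gamma> \<phi> \<psi>)
  then obtain \<Delta> \<Delta>' where "\<Delta> \<subseteq> \<Gamma>" "finite \<Delta>" "\<Delta> \<turnstile> \<phi> \<^bold>\<longrightarrow> \<psi>" "\<Delta>' \<subseteq> \<Gamma>" "finite \<Delta>'" "\<Delta>' \<turnstile> \<phi>"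
    by blast
  moreover have "\<Delta> \<union> \<Delta>' \<turnstile> \<psi>"
    by (rule deriv.ImpE[OF deriv_mono[OF \<open>\<Delta> \<turnstile> \<phi> \<^bold>\<longrightarrow> \<psi>\<close>] deriv_mono[OF \<open>\<Delta>' \<turnstile> \<phi>\<close>]]) auto
  ultimately show ?case by (intro exI[of _ "\<Delta> \<union> \<Delta>'"]) auto
next
  case (Contr \<phi> \<Gamma>)
  then obtain \<Delta> where "\<Delta> \<subseteq> insert (\<^bold>\<not>\<phi>) \<Gamma>" "finite \<Delta>" "\<Delta> \<turnstile> \<^bold>\<bottom>" by blast
  moreover from \<open>\<Delta> \<turnstile> \<^bold>\<bottom>\<close> have "insert (\<^bold>\<not>\<phi>) (\<Delta> - {\<^bold>\<not>\<phi>}) \<turnstile> \<^bold>\<bottom>"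
    by (rule deriv_mono) blast
  then have "\<Delta> - {\<^bold>\<not>\<phi>} \<turnstile> \<phi>" by (rule deriv.Contr)
  ultimately show ?case by (intro exI[of _ "\<Delta> - {\<^bold>\<not>\<phi>}"]) auto
next
  case (AllI \<Gamma> \<phi>)
  then obtain \<Delta> where "\<Delta> \<subseteq> rename Suc ` \<Gamma>" "finite \<Delta>" "\<Delta> \<turnstile> \<phi>" by blast
  then obtain \<Delta>' where "\<Delta>' \<subseteq> \<Gamma>" "finite \<Delta>'" "\<Delta> = rename Suc ` \<Delta>'"
    by (metis finite_subset_image)
  then show ?case using \<open>\<Delta> \<turnstile> \<phi>\<close> by (blast intro: deriv.AllI)
next
  case (AllE \<Gamma> \<phi> t)
  then show ?case by (blast intro: deriv.AllE)
next
  case (EqRefl \<Gamma> x)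
  then show ?case by (intro exI[of _ "{}"]) (auto intro: deriv.EqRefl)
next
  case (EqSubst \<Gamma> x y \<phi>)
  then obtain \<Delta> \<Delta>' where
    "\<Delta> \<subseteq> \<Gamma>" "finite \<Delta>" "\<Delta> \<turnstile> x \<^bold>= y" "\<Delta>' \<subseteq> \<Gamma>" "finite \<Delta>'" "\<Delta>' \<turnstile> inst x \<phi>"
    by blast
  moreover have "\<Delta> \<union> \<Delta>' \<turnstile> inst y \<phi>"
    by (rule deriv.EqSubst[OF deriv_mono[OF \<open>\<Delta> \<turnstile> x \<^bold>= y\<close>] deriv_mono[OF \<open>\<Delta>' \<turnstile> inst x \<phi>\<close>]]) auto
  ultimately show ?case by (intro exI[of _ "\<Delta> \<union> \<Delta>'"]) auto
qed

lemma deriv_insert_Neg: "insert \<phi> \<Gamma> \<turnstile> \<^bold>\<bottom> \<Longrightarrow> insert (\<^bold>\<not>\<phi>) \<Gamma> \<turnstile> \<^bold>\<bottom> \<Longrightarrow> \<Gamma> \<turnstile> \<^bold>\<bottom>"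
  by (blast intro: deriv.intros)

text \<open>The renaming \<open>?r\<close> sends \<open>c\<close> to 0 and shifts everything else.
  On the assumptions, where \<open>c\<close> is absent, it agrees with \<open>Suc\<close>; on
  \<open>inst c \<phi>\<close> it undoes the instantiation. The result is a premise for
  \<open>AllI\<close>.\<close>

lemma deriv_All_fresh:
  assumes "\<Gamma> \<turnstile> inst c \<phi>" and fresh: "\<forall>\<psi>\<in>\<Gamma>. c \<notin> fv \<psi>" "c \<notin> fv (\<^bold>\<forall>\<phi>)"
  shows "\<Gamma> \<turnstile> \<^bold>\<forall>\<phi>"
proof -
  let ?r = "\<lambda>i. if i = c then 0 else Suc i"
  have 1: "rename ?r ` \<Gamma> = rename Suc ` \<Gamma>"
    using fresh by (intro image_cong refl rename_cong) auto
  have 2: "rename ?r (inst c \<phi>) = \<phi>"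
  proof -
    have "rename ?r (inst c \<phi>) = rename (\<lambda>i. i) \<phi>"
      unfolding inst_def rename_rename using fresh(2)
      by (intro rename_cong) (auto split: nat.split)
    then show ?thesis by (simp add: rename_ident)
  qed
  show ?thesis
    using deriv_rename[OF assms(1), of ?r] unfolding 1 2 by (rule deriv.AllI)
qed

section \<open>Henkin theories and the term model\<close>

instance fm :: countable
  by countable_datatype

definition free_names :: "fm set \<Rightarrow> nat set" where
  "free_names \<Gamma> = - (\<Union>\<phi>\<in>\<Gamma>. fv \<phi>)"

lemma infinite_free_names_insert:
  "infinite (free_names \<Gamma>) \<Longrightarrow> infinite (free_names (insert \<phi> \<Gamma>))"
proof -
  assume "infinite (free_names \<Gamma>)"
  moreover have "free_names (insert \<phi> \<Gamma>) = free_names \<Gamma> - fv \<phi>"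
    unfolding free_names_def by auto
  ultimately show ?thesis using finite_fv by (metis Diff_infinite_finite)
qed

text \<open>Add \<open>\<chi>\<close> if that is consistent, otherwise its negation. If the refuted
  \<open>\<chi>\<close> is universal, a counterexample at a fresh \<open>c\<close> is added too;
  were it inconsistent, \<open>deriv_All_fresh\<close> would derive \<open>\<chi>\<close>.\<close>

lemma henkin_step:
  assumes con: "\<not> \<Gamma> \<turnstile> \<^bold>\<bottom>" and inf: "infinite (free_names \<Gamma>)"
  shows "\<exists>\<Delta>. \<not> \<Delta> \<turnstile> \<^bold>\<bottom> \<and> infinite (free_names \<Delta>) \<and> \<Gamma> \<subseteq> \<Delta> \<and>
    (\<chi> \<in> \<Delta> \<or> \<^bold>\<not>\<chi> \<in> \<Delta> \<and> (\<forall>\<phi>. \<chi> = \<^bold>\<forall>\<phi> \<longrightarrow> (\<exists>c. \<^bold>\<not>(inst c \<phi>) \<in> \<Delta>)))"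
proof (cases "insert \<chi> \<Gamma> \<turnstile> \<^bold>\<bottom>")
  case False
  then show ?thesis
    using infinite_free_names_insert[OF inf, of \<chi>] by (intro exI[of _ "insert \<chi> \<Gamma>"]) auto
next
  case True
  define \<Delta> where "\<Delta> = insert (\<^bold>\<not>\<chi>) \<Gamma>"
  have con': "\<not> \<Delta> \<turnstile> \<^bold>\<bottom>"
    using True con deriv_insert_Neg unfolding \<Delta>_def by blast
  have inf': "infinite (free_names \<Delta>)"
    using infinite_free_names_insert[OF inf] unfolding \<Delta>_def by blast
  show ?thesis
  proof (cases "\<exists>\<phi>. \<chi> = \<^bold>\<forall>\<phi>")
    case False
    then show ?thesis using con' inf' by (intro exI[of _ \<Delta>]) (auto simp: \<Delta>_def)
  next
    case True
    then obtain \<phi> where \<phi>: "\<chi> = \<^bold>\<forall>\<phi>" by blast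
    obtain c where c: "c \<in> free_names \<Delta>"
      using inf' infinite_imp_nonempty by blast
    have "\<not> insert (\<^bold>\<not>(inst c \<phi>)) \<Delta> \<turnstile> \<^bold>\<bottom>"
    proof
      assume "insert (\<^bold>\<not>(inst c \<phi>)) \<Delta> \<turnstile> \<^bold>\<bottom>"
      then have "\<Delta> \<turnstile> inst c \<phi>" by (rule deriv.Contr)
      moreover have "\<forall>\<psi>\<in>\<Delta>. c \<notin> fv \<psi>" using c unfolding free_names_def by auto
      ultimately have "\<Delta> \<turnstile> \<chi>"
        using deriv_All_fresh[of \<Delta> c \<phi>] \<phi> unfolding \<Delta>_def by auto
      moreover have "\<Delta> \<turnstile> \<^bold>\<not>\<chi>" unfolding \<Delta>_def by (simp add: deriv.Assm)
      ultimately show False using con' deriv.ImpE by blast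
    qed
    then show ?thesis
      using \<phi> infinite_free_names_insert[OF inf']
      by (intro exI[of _ "insert (\<^bold>\<not>(inst c \<phi>)) \<Delta>"]) (auto simp: \<Delta>_def)
  qed
qed

lemma henkin_extension:
  assumes con: "\<not> \<Gamma> \<turnstile> \<^bold>\<bottom>" and inf: "infinite (free_names \<Gamma>)"
  obtains T where "\<Gamma> \<subseteq> T" "\<not> T \<turnstile> \<^bold>\<bottom>" "\<And>\<phi>. \<phi> \<in> T \<or> \<^bold>\<not>\<phi> \<in> T"
    "\<And>\<phi>. \<^bold>\<not>\<^bold>\<forall>\<phi> \<in> T \<Longrightarrow> \<exists>c. \<^bold>\<not>(inst c \<phi>) \<in> T"
proof -
  \<comment> \<open>Stage \<open>n + 1\<close> decides the formula with code \<open>n\<close>. The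
    clause for \<open>n = 0\<close> makes the chain start above \<open>\<Gamma>\<close>.\<close>
  let ?P = "\<lambda>(n::nat) \<Delta>. \<not> \<Delta> \<turnstile> \<^bold>\<bottom> \<and> infinite (free_names \<Delta>) \<and> (n = 0 \<longrightarrow> \<Gamma> \<subseteq> \<Delta>)"
  let ?Q = "\<lambda>(n::nat) \<Gamma> \<Delta>. \<Gamma> \<subseteq> \<Delta> \<and> (from_nat n \<in> \<Delta> \<or>
    \<^bold>\<not>(from_nat n) \<in> \<Delta> \<and> (\<forall>\<phi>. from_nat n = \<^bold>\<forall>\<phi> \<longrightarrow> (\<exists>c. \<^bold>\<not>(inst c \<phi>) \<in> \<Delta>)))"
  have "\<exists>f. \<forall>n. ?P n (f n) \<and> ?Q n (f n) (f (Suc n))"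
  proof (rule dependent_nat_choice)
    show "\<exists>\<Delta>. ?P 0 \<Delta>" using con inf by blast
  next
    fix \<Delta> n assume "?P n \<Delta>"
    then obtain \<Delta>' where "\<not> \<Delta>' \<turnstile> \<^bold>\<bottom> \<and> infinite (free_names \<Delta>') \<and> \<Delta> \<subseteq> \<Delta>' \<and>
      (from_nat n \<in> \<Delta>' \<or>
       \<^bold>\<not>(from_nat n) \<in> \<Delta>' \<and> (\<forall>\<phi>. from_nat n = \<^bold>\<forall>\<phi> \<longrightarrow> (\<exists>c. \<^bold>\<not>(inst c \<phi>) \<in> \<Delta>')))"
      using henkin_step[of \<Delta> "from_nat n"] by blast
    then show "\<exists>\<Delta>'. ?P (Suc n) \<Delta>' \<and> ?Q n \<Delta> \<Delta>'" by auto
  qed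
  then obtain f where "\<forall>n. ?P n (f n) \<and> ?Q n (f n) (f (Suc n))" by (rule exE)
  then have f: "?P n (f n)" "?Q n (f n) (f (Suc n))" for n by simp_all
  have mono: "f m \<subseteq> f n" if "m \<le> n" for m n
    using lift_Suc_mono_le[of f, OF _ that] f(2) by blast
  define T where "T = (\<Union>n. f n)"
  have con_T: "\<not> T \<turnstile> \<^bold>\<bottom>"
  proof
    assume "T \<turnstile> \<^bold>\<bottom>"
    then obtain \<Delta> where \<Delta>: "\<Delta> \<subseteq> T" "finite \<Delta>" "\<Delta> \<turnstile> \<^bold>\<bottom>" using deriv_finite by blast
    have "\<exists>n. \<Delta> \<subseteq> f n" using \<Delta>(2,1)
    proof (induction \<Delta> rule: finite_induct)
      case (insert \<phi> \<Delta>)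
      then obtain m n where "\<phi> \<in> f m" "\<Delta> \<subseteq> f n" unfolding T_def by auto
      then have "insert \<phi> \<Delta> \<subseteq> f (max m n)"
        using mono[of m "max m n"] mono[of n "max m n"] by auto
      then show ?case ..
    qed simp
    then show False using \<Delta>(3) deriv_mono f(1) by blast
  qed
  have dec: "\<phi> \<in> T \<or> \<^bold>\<not>\<phi> \<in> T \<and> (\<forall>\<psi>. \<phi> = \<^bold>\<forall>\<psi> \<longrightarrow> (\<exists>c. \<^bold>\<not>(inst c \<psi>) \<in> T))" for \<phi>
    using f(2)[of "to_nat \<phi>"] unfolding T_def by simp blast
  show thesis
  proof
    show "\<Gamma> \<subseteq> T" using f(1)[of 0] unfolding T_def by auto
    show "\<not> T \<turnstile> \<^bold>\<bottom>" by (fact con_T)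
    show "\<phi> \<in> T \<or> \<^bold>\<not>\<phi> \<in> T" for \<phi> using dec by blast
    show "\<exists>c. \<^bold>\<not>(inst c \<phi>) \<in> T" if "\<^bold>\<not>\<^bold>\<forall>\<phi> \<in> T" for \<phi>
    proof -
      have "\<^bold>\<forall>\<phi> \<notin> T"
        using that con_T by (meson deriv.Assm deriv.ImpE)
      then show ?thesis using dec[of "\<^bold>\<forall>\<phi>"] by blast
    qed
  qed
qed

text \<open>The domain is an explicit set, so that one definition covers the term model, models on a
  whole type, and \<open>V_\<delta>\<close> as a substructure.\<close>

primrec sat :: "'a set \<Rightarrow> ('a \<Rightarrow> 'a \<Rightarrow> bool) \<Rightarrow> (nat \<Rightarrow> 'a) \<Rightarrow> fm \<Rightarrow> bool" where
  "sat D E e (x \<^bold>\<in> y) = E (e x) (e y)"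
| "sat D E e (x \<^bold>= y) = (e x = e y)"
| "sat D E e \<^bold>\<bottom> = False"
| "sat D E e (\<phi> \<^bold>\<longrightarrow> \<psi>) = (sat D E e \<phi> \<longrightarrow> sat D E e \<psi>)"
| "sat D E e (\<^bold>\<forall>\<phi>) = (\<forall>x\<in>D. sat D E (case_nat x e) \<phi>)"

lemma sat_connectives [simp]:
  "sat D E e (\<phi> \<^bold>\<and> \<psi>) \<longleftrightarrow> sat D E e \<phi> \<and> sat D E e \<psi>"
  "sat D E e (\<phi> \<^bold>\<or> \<psi>) \<longleftrightarrow> sat D E e \<phi> \<or> sat D E e \<psi>"
  "sat D E e (\<^bold>\<exists>\<phi>) \<longleftrightarrow> (\<exists>x\<in>D. sat D E (case_nat x e) \<phi>)"
  by auto

lemma sat_Iff [simp]: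
  "sat D E e (\<phi> \<^bold>\<longleftrightarrow> \<psi>) \<longleftrightarrow> (sat D E e \<phi> \<longleftrightarrow> sat D E e \<psi>)"
  by auto

lemma sat_cong: "(\<And>i. i \<in> fv \<phi> \<Longrightarrow> e i = e' i) \<Longrightarrow> sat D E e \<phi> = sat D E e' \<phi>"
proof (induction \<phi> arbitrary: e e')
  case (Imp \<phi> \<psi>)
  then show ?case by (metis UnCI fv.simps(4) sat.simps(4))
next
  case (All \<phi>)
  have "sat D E (case_nat x e) \<phi> = sat D E (case_nat x e') \<phi>" for x
    using All.prems by (intro All.IH) (auto split: nat.split)
  then show ?case by simp
qed auto

lemma sat_rename: "sat D E e (rename r \<phi>) = sat D E (\<lambda>i. e (r i)) \<phi>"
proof (induction \<phi> arbitrary: e r)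
  case (All \<phi>)
  have "(\<lambda>i. case_nat x e (case_nat 0 (\<lambda>i. Suc (r i)) i)) = case_nat x (\<lambda>i. e (r i))" for x
    by (auto split: nat.split)
  then show ?case using All by simp
qed auto

text \<open>Used to copy a countably infinite model onto the natural numbers. Injectivity of
  \<open>g\<close> serves equality, surjectivity the quantifier.\<close>

lemma sat_iso:
  assumes "bij_betw g A D"
  shows "range e \<subseteq> A \<Longrightarrow> sat A (\<lambda>x y. E (g x) (g y)) e \<phi> = sat D E (\<lambda>i. g (e i)) \<phi>"
proof (induction \<phi> arbitrary: e)
  case (Eq x y)
  then show ?case using assms by (auto simp: bij_betw_def inj_on_eq_iff image_subset_iff)
next
  case (All \<phi>)
  have "(\<lambda>i. g (case_nat x e i)) = case_nat (g x) (\<lambda>i. g (e i))" for x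
    by (auto split: nat.split)
  moreover have "range (case_nat x e) \<subseteq> A" if "x \<in> A" for x
    using that All.prems by (auto split: nat.split simp: image_subset_iff)
  ultimately have "sat A (\<lambda>x y. E (g x) (g y)) (case_nat x e) \<phi>
      = sat D E (case_nat (g x) (\<lambda>i. g (e i))) \<phi>" if "x \<in> A" for x
    using that All.IH by simp
  moreover have "D = g ` A" using assms by (simp add: bij_betw_def)
  ultimately show ?case by simp
qed auto

text \<open>The elements are the variables modulo the equalities in a Henkin theory
  \<open>T\<close>; being sets of variables, they have type \<open>nat set\<close>. Each free
  variable denotes its own class.\<close>

lemma model_existence:
  assumes con: "\<not> \<Gamma> \<turnstile> \<^bold>\<bottom>" and inf: "infinite (free_names \<Gamma>)"
  shows "\<exists>(D :: nat set set) E e. range e \<subseteq> D \<and> countable D \<and> (\<forall>\<phi>\<in>\<Gamma>. sat D E e \<phi>)"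
proof -
  obtain T where T: "\<Gamma> \<subseteq> T" "\<not> T \<turnstile> \<^bold>\<bottom>" "\<And>\<phi>. \<phi> \<in> T \<or> \<^bold>\<not>\<phi> \<in> T"
    "\<And>\<phi>. \<^bold>\<not>\<^bold>\<forall>\<phi> \<in> T \<Longrightarrow> \<exists>c. \<^bold>\<not>(inst c \<phi>) \<in> T"
    using henkin_extension[OF con inf] by blast
  have closed: "\<phi> \<in> T" if "T \<turnstile> \<phi>" for \<phi>
    using T(2,3) that by (meson deriv.Assm deriv.ImpE)
  have Neg: "\<^bold>\<not>\<phi> \<in> T \<longleftrightarrow> \<phi> \<notin> T" for \<phi>
    using T(2,3) by (meson deriv.Assm deriv.ImpE)
  have Imp: "(\<phi> \<^bold>\<longrightarrow> \<psi>) \<in> T \<longleftrightarrow> (\<phi> \<in> T \<longrightarrow> \<psi> \<in> T)" for \<phi> \<psi>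
  proof
    assume "(\<phi> \<^bold>\<longrightarrow> \<psi>) \<in> T"
    then show "\<phi> \<in> T \<longrightarrow> \<psi> \<in> T" by (meson closed deriv.Assm deriv.ImpE)
  next
    assume A: "\<phi> \<in> T \<longrightarrow> \<psi> \<in> T"
    show "(\<phi> \<^bold>\<longrightarrow> \<psi>) \<in> T"
    proof (cases "\<phi> \<in> T")
      case True
      then show ?thesis using A closed[OF deriv.ImpI[OF deriv.Assm]] by blast
    next
      case False
      then have "\<^bold>\<not>\<phi> \<in> T" using Neg by blast
      then have "insert \<phi> T \<turnstile> \<^bold>\<bottom>" by (meson deriv.Assm deriv.ImpE insertI1 insertI2)
      then have "insert (\<^bold>\<not>\<psi>) (insert \<phi> T) \<turnstile> \<^bold>\<bottom>" by (rule deriv_mono) blast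
      then show ?thesis using closed[OF deriv.ImpI[OF deriv.Contr]] by blast
    qed
  qed
  have All: "\<^bold>\<forall>\<phi> \<in> T \<longleftrightarrow> (\<forall>t. inst t \<phi> \<in> T)" for \<phi>
    using T(4)[of \<phi>] Neg by (meson closed deriv.AllE deriv.Assm)
  have subst: "inst y \<phi> \<in> T" if "(x \<^bold>= y) \<in> T" "inst x \<phi> \<in> T" for x y \<phi>
    using that by (meson closed deriv.Assm deriv.EqSubst)
  have refl: "(x \<^bold>= x) \<in> T" for x by (simp add: closed deriv.EqRefl)
  \<comment> \<open>In the following instances of Leibniz's law, variable 0 marks the place of
    replacement and \<open>Suc\<close> keeps the other variable away from it.\<close>
  have sym: "(y \<^bold>= x) \<in> T" if "(x \<^bold>= y) \<in> T" for x y
    using subst[OF that, of "0 \<^bold>= Suc x"] refl by (simp add: inst_def)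
  have trans: "(x \<^bold>= z) \<in> T" if "(x \<^bold>= y) \<in> T" "(y \<^bold>= z) \<in> T" for x y z
    using subst[OF that(2), of "Suc x \<^bold>= 0"] that(1) by (simp add: inst_def)
  have mem1: "(x' \<^bold>\<in> y) \<in> T" if "(x \<^bold>\<in> y) \<in> T" "(x \<^bold>= x') \<in> T" for x x' y
    using subst[OF that(2), of "0 \<^bold>\<in> Suc y"] that(1) by (simp add: inst_def)
  have mem2: "(x \<^bold>\<in> y') \<in> T" if "(x \<^bold>\<in> y) \<in> T" "(y \<^bold>= y') \<in> T" for x y y'
    using subst[OF that(2), of "Suc x \<^bold>\<in> 0"] that(1) by (simp add: inst_def)
  define cl where "cl = (\<lambda>x. {y. (x \<^bold>= y) \<in> T})"
  have cl: "cl x = cl y \<longleftrightarrow> (x \<^bold>= y) \<in> T" for x y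
    unfolding cl_def using refl sym trans by blast
  define E where "E = (\<lambda>a b. \<exists>x y. a = cl x \<and> b = cl y \<and> (x \<^bold>\<in> y) \<in> T)"
  have E: "E (cl x) (cl y) \<longleftrightarrow> (x \<^bold>\<in> y) \<in> T" for x y
    unfolding E_def cl using mem1 mem2 refl sym by meson
  \<comment> \<open>All renamings are treated at once because the quantifier case must replace
    variable 0 of the body by every \<open>t\<close>.\<close>
  have truth: "rename r \<phi> \<in> T \<longleftrightarrow> sat (range cl) E (\<lambda>i. cl (r i)) \<phi>" for r \<phi>
  proof (induction \<phi> arbitrary: r)
    case Fls
    then show ?case using T(2) by (auto intro: deriv.Assm)
  next
    case (All \<phi>)
    have 1: "inst t (rename (case_nat 0 (\<lambda>i. Suc (r i))) \<phi>) = rename (case_nat t r) \<phi>" for t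
      unfolding inst_def rename_rename by (rule rename_cong) (auto split: nat.split)
    have 2: "case_nat (cl t) (\<lambda>i. cl (r i)) = (\<lambda>i. cl (case_nat t r i))" for t
      by (rule ext) (simp split: nat.split)
    show ?case unfolding rename.simps \<open>\<And>\<phi>. \<^bold>\<forall>\<phi> \<in> T \<longleftrightarrow> _\<close> 1 All.IH by (simp add: 2)
  qed (auto simp: Imp E cl)
  have "sat (range cl) E cl \<phi>" if "\<phi> \<in> \<Gamma>" for \<phi>
    using truth[of "\<lambda>i. i" \<phi>] that T(1) by (auto simp: rename_ident)
  then show ?thesis
    by (intro exI[of _ "range cl"] exI[of _ E] exI[of _ cl]) auto
qed

text \<open>In a finite model, Pairing and Union collect all elements into one set \<open>u\<close>.
  Then \<open>u\<close> is a member of itself, and its singleton contradicts Foundation.\<close>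

lemma ZFC_model_infinite:
  assumes mod: "\<forall>\<phi>\<in>ZFC. sat D E e \<phi>" and ne: "D \<noteq> {}"
  shows "infinite D"
proof
  assume fin: "finite D"
  have ax: "sat D E e pairing" "sat D E e union_ax" "sat D E e foundation"
    using mod by (auto simp: ZFC_def)
  have pair: "\<exists>p\<in>D. \<forall>z\<in>D. E z p \<longleftrightarrow> z = x \<or> z = y" if "x \<in> D" "y \<in> D" for x y
    using ax(1) that
    unfolding pairing_def sat.simps(5) sat_connectives(3) sat_Iff
    by (simp add: eval_nat_numeral disj_imp)
  have union: "\<exists>u\<in>D. \<forall>z\<in>D. E z u \<longleftrightarrow> (\<exists>y\<in>D. E y x \<and> E z y)" if "x \<in> D" for x
    using ax(2) that
    unfolding union_ax_def sat.simps(5) sat_connectives(3) sat_Iff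
    by (simp add: eval_nat_numeral)
  have found: "\<exists>y\<in>D. E y x \<and> \<not> (\<exists>z\<in>D. E z y \<and> E z x)" if "x \<in> D" "y \<in> D" "E y x" for x y
    using ax(3) that by (auto simp: foundation_def eval_nat_numeral)
  have "\<exists>u\<in>D. \<forall>z\<in>F. E z u" if "finite F" "F \<subseteq> D" for F
    using that
  proof (induction F rule: finite_induct)
    case empty
    then show ?case using ne by auto
  next
    case (insert a F)
    then obtain u where u: "u \<in> D" "\<forall>z\<in>F. E z u" by auto
    have a: "a \<in> D" "F \<subseteq> D" using insert.prems by auto
    obtain b where b: "b \<in> D" "\<forall>z\<in>D. E z b \<longleftrightarrow> z = a \<or> z = a" using pair a(1) by blast
    obtain p where p: "p \<in> D" "\<forall>z\<in>D. E z p \<longleftrightarrow> z = u \<or> z = b" using pair u(1) b(1) by blast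
    obtain v where v: "v \<in> D" "\<forall>z\<in>D. E z v \<longleftrightarrow> (\<exists>y\<in>D. E y p \<and> E z y)"
      using union p(1) by blast
    have "\<forall>z\<in>insert a F. E z v" using u a b p v by blast
    then show ?case using v(1) by blast
  qed
  then obtain u where u: "u \<in> D" "\<forall>z\<in>D. E z u" using fin by blast
  obtain p where p: "p \<in> D" "\<forall>z\<in>D. E z p \<longleftrightarrow> z = u \<or> z = u" using pair u(1) by blast
  then show False using found[of p u] u by metis
qed

text \<open>All models may be taken on the set of natural numbers: the term model is countable, and
  it is infinite because it satisfies ZFC.\<close>

theorem ZFC_completeness:
  assumes ZFC: "ZFC \<subseteq> \<Gamma>"
    and valid: "\<And>(E :: nat \<Rightarrow> nat \<Rightarrow> bool) e. \<forall>\<psi>\<in>\<Gamma>. sat UNIV E e \<psi> \<Longrightarrow> sat UNIV E e \<phi>"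
  shows "\<Gamma> \<turnstile> \<phi>"
proof (rule ccontr)
  assume not: "\<not> \<Gamma> \<turnstile> \<phi>"
  define \<Gamma>' where "\<Gamma>' = insert (\<^bold>\<not>\<phi>) \<Gamma>"
  \<comment> \<open>Doubling all indices frees infinitely many variables for use as Henkin witnesses.\<close>
  define \<Delta> where "\<Delta> = rename (\<lambda>i. 2 * i) ` \<Gamma>'"
  have "rename (\<lambda>i. i div 2) ` \<Delta> = \<Gamma>'"
    unfolding \<Delta>_def by (auto simp: image_image rename_rename rename_ident)
  then have "\<not> \<Delta> \<turnstile> \<^bold>\<bottom>"
    using not deriv_rename[of \<Delta> "\<^bold>\<bottom>" "\<lambda>i. i div 2"] unfolding \<Gamma>'_def
    by (auto intro: deriv.Contr)
  moreover have "infinite (free_names \<Delta>)"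
  proof -
    have "range (\<lambda>i. 2 * i + 1) \<subseteq> free_names \<Delta>"
      unfolding free_names_def \<Delta>_def by (auto simp: fv_rename) presburger
    moreover have "infinite (range (\<lambda>i::nat. 2 * i + 1))"
      by (intro range_inj_infinite injI) simp
    ultimately show ?thesis using infinite_super by blast
  qed
  ultimately obtain D :: "nat set set" and E e where
    D: "range e \<subseteq> D" "countable D" "\<forall>\<psi>\<in>\<Delta>. sat D E e \<psi>"
    using model_existence by blast
  define e' where "e' = (\<lambda>i. e (2 * i))"
  have sat': "sat D E e' \<psi>" if "\<psi> \<in> \<Gamma>'" for \<psi>
    using D(3) that unfolding \<Delta>_def e'_def by (auto simp: sat_rename)
  have "infinite D"
    using ZFC D(1) sat' ZFC_model_infinite[of D E e'] unfolding \<Gamma>'_def by blast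
  then obtain g where g: "bij_betw g (UNIV :: nat set) D"
    using D(2) bij_betw_from_nat_into by blast
  define d where "d = (\<lambda>i. inv_into UNIV g (e' i))"
  have gd: "(\<lambda>i. g (d i)) = e'"
    using g D(1) unfolding d_def e'_def by (auto simp: bij_betw_def f_inv_into_f image_subset_iff)
  have "sat UNIV (\<lambda>x y. E (g x) (g y)) d \<psi>" if "\<psi> \<in> \<Gamma>'" for \<psi>
    using sat_iso[OF g, of d E \<psi>] sat'[OF that] unfolding gd by simp
  then show False using valid[of "\<lambda>x y. E (g x) (g y)" d] unfolding \<Gamma>'_def
    by (metis insertI1 insertI2 sat.simps(3,4))
qed

section \<open>Completeness of S5 for finite universal frames\<close>

text \<open>Necessitation acts only inside \<open>S5\<close> and never on hypotheses; this is what
  makes the deduction theorem true.\<close>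

inductive S5_deriv :: "pm set \<Rightarrow> pm \<Rightarrow> bool" for \<Gamma> where
  hyp: "p \<in> \<Gamma> \<Longrightarrow> S5_deriv \<Gamma> p"
| axm: "p \<in> S5 \<Longrightarrow> S5_deriv \<Gamma> p"
| detach: "S5_deriv \<Gamma> (PImp p q) \<Longrightarrow> S5_deriv \<Gamma> p \<Longrightarrow> S5_deriv \<Gamma> q"

lemma S5_deriv_mono: "S5_deriv \<Gamma> p \<Longrightarrow> \<Gamma> \<subseteq> \<Delta> \<Longrightarrow> S5_deriv \<Delta> p"
  by (induction rule: S5_deriv.induct) (auto intro: S5_deriv.intros)

lemma S5_deriv_empty: "S5_deriv {} p \<Longrightarrow> p \<in> S5"
  by (induction rule: S5_deriv.induct) (auto intro: S5.MP)

lemma S5_imp_refl: "PImp p p \<in> S5"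
  by (meson S5.A1 S5.A2 S5.MP)

lemma S5_deduction: "S5_deriv (insert p \<Gamma>) q \<Longrightarrow> S5_deriv \<Gamma> (PImp p q)"
proof (induction rule: S5_deriv.induct)
  case (hyp q)
  then show ?case by (metis S5.A1 S5_deriv.simps S5_imp_refl insertE)
next
  case (axm q)
  then show ?case by (meson S5.A1 S5.MP S5_deriv.axm)
next
  case (detach q r)
  then show ?case by (meson S5.A2 S5_deriv.detach S5_deriv.axm)
qed

lemma S5_deriv_finite: "S5_deriv \<Gamma> p \<Longrightarrow> \<exists>\<Delta>\<subseteq>\<Gamma>. finite \<Delta> \<and> S5_deriv \<Delta> p"
proof (induction rule: S5_deriv.induct)
  case (hyp p)
  then show ?case by (intro exI[of _ "{p}"]) (auto intro: S5_deriv.hyp)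
next
  case (axm p)
  then show ?case by (intro exI[of _ "{}"]) (auto intro: S5_deriv.axm)
next
  case (detach p q)
  then obtain \<Delta> \<Delta>' where "\<Delta> \<subseteq> \<Gamma>" "finite \<Delta>" "S5_deriv \<Delta> (PImp p q)"
    "\<Delta>' \<subseteq> \<Gamma>" "finite \<Delta>'" "S5_deriv \<Delta>' p"
    by blast
  then show ?case
    by (intro exI[of _ "\<Delta> \<union> \<Delta>'"])
      (auto intro: S5_deriv.detach S5_deriv_mono[of \<Delta>] S5_deriv_mono[of \<Delta>'])
qed

lemma S5_deriv_box: "S5_deriv \<Gamma> p \<Longrightarrow> S5_deriv (PBox ` \<Gamma>) (PBox p)"
proof (induction rule: S5_deriv.induct)
  case (detach p q)
  then show ?case by (meson S5.K S5_deriv.detach S5_deriv.axm)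
qed (auto intro: S5_deriv.intros S5.Nec)

section \<open>Maximal consistent sets of modal formulas\<close>

definition mcs :: "pm set \<Rightarrow> bool" where
  "mcs w \<longleftrightarrow> \<not> S5_deriv w PFls \<and> (\<forall>p. p \<notin> w \<longrightarrow> S5_deriv (insert p w) PFls)"

text \<open>Zorn's lemma applies because a refutation uses finitely many hypotheses, which lie in a
  single member of a chain.\<close>

lemma mcs_extension:
  assumes "\<not> S5_deriv \<Gamma> PFls"
  obtains w where "mcs w" "\<Gamma> \<subseteq> w"
proof -
  let ?A = "{\<Delta>. \<Gamma> \<subseteq> \<Delta> \<and> \<not> S5_deriv \<Delta> PFls}"
  have "\<exists>w\<in>?A. \<forall>\<Delta>\<in>?A. w \<subseteq> \<Delta> \<longrightarrow> \<Delta> = w"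
  proof (rule subset_Zorn_nonempty)
    show "?A \<noteq> {}" using assms by auto
  next
    fix C assume C: "C \<noteq> {}" "subset.chain ?A C"
    have "\<not> S5_deriv (\<Union>C) PFls"
    proof
      assume "S5_deriv (\<Union>C) PFls"
      then obtain \<Delta> where \<Delta>: "\<Delta> \<subseteq> \<Union>C" "finite \<Delta>" "S5_deriv \<Delta> PFls"
        using S5_deriv_finite by blast
      then obtain X where "X \<in> C" "\<Delta> \<subseteq> X"
        using finite_subset_Union_chain[OF \<Delta>(2,1) C] by blast
      then show False
        using S5_deriv_mono[OF \<Delta>(3)] C(2) unfolding subset.chain_def by blast
    qed
    then show "\<Union>C \<in> ?A" using C unfolding subset.chain_def by blast
  qed
  then obtain w where w: "w \<in> ?A" "\<forall>\<Delta>\<in>?A. w \<subseteq> \<Delta> \<longrightarrow> \<Delta> = w" by (rule bexE)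
  have "S5_deriv (insert p w) PFls" if "p \<notin> w" for p
  proof (rule ccontr)
    assume "\<not> S5_deriv (insert p w) PFls"
    then have "insert p w \<in> ?A" using w(1) by auto
    then show False using w(2) that by (metis insertI1 subset_insertI)
  qed
  then have "mcs w" using w(1) unfolding mcs_def by simp
  then show thesis using that w(1) by simp
qed

lemma mcs_closed: "mcs w \<Longrightarrow> S5_deriv w p \<Longrightarrow> p \<in> w"
  unfolding mcs_def by (meson S5_deduction S5_deriv.detach)

lemma mcs_S5: "mcs w \<Longrightarrow> p \<in> S5 \<Longrightarrow> p \<in> w"
  by (simp add: S5_deriv.axm mcs_closed)

lemma mcs_PFls: "mcs w \<Longrightarrow> PFls \<notin> w"
  unfolding mcs_def by (auto intro: S5_deriv.hyp)

lemma mcs_PImp: "mcs w \<Longrightarrow> PImp p q \<in> w \<longleftrightarrow> (p \<in> w \<longrightarrow> q \<in> w)"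
proof
  assume "mcs w" "PImp p q \<in> w"
  then show "p \<in> w \<longrightarrow> q \<in> w" by (meson S5_deriv.hyp S5_deriv.detach mcs_closed)
next
  assume w: "mcs w" and A: "p \<in> w \<longrightarrow> q \<in> w"
  show "PImp p q \<in> w"
  proof (cases "p \<in> w")
    case True
    then show ?thesis
      using A mcs_closed[OF w S5_deduction[OF S5_deriv.hyp]] by blast
  next
    case False
    then have "S5_deriv (insert p w) PFls" using w unfolding mcs_def by blast
    then have "S5_deriv (insert p w) (PImp (PNeg q) PFls)"
      by (meson S5.A1 S5_deriv.detach S5_deriv.axm)
    then have "S5_deriv (insert p w) q" by (meson S5.A3 S5_deriv.detach S5_deriv.axm)
    then show ?thesis by (rule mcs_closed[OF w S5_deduction])
  qed
qed

lemmas mcs_simps = mcs_PFls mcs_PImp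

text \<open>With this, theoremhood can be checked by computing membership with
  \<open>mcs_simps\<close> instead of building Hilbert derivations.\<close>

lemma S5_by_mcs: "(\<And>w. mcs w \<Longrightarrow> p \<in> w) \<Longrightarrow> p \<in> S5"
proof (rule ccontr)
  assume all: "\<And>w. mcs w \<Longrightarrow> p \<in> w" and "p \<notin> S5"
  have "\<not> S5_deriv {PNeg p} PFls"
  proof
    assume "S5_deriv {PNeg p} PFls"
    then have "PNeg (PNeg p) \<in> S5" by (intro S5_deriv_empty S5_deduction)
    then show False using \<open>p \<notin> S5\<close> S5.A3 S5.MP by blast
  qed
  then obtain w where "mcs w" "PNeg p \<in> w" using mcs_extension by blast
  then show False using all by (auto simp: mcs_simps)
qed

lemma mcs_box_mono:
  assumes "mcs w" "PBox p \<in> w" "\<And>v. mcs v \<Longrightarrow> p \<in> v \<Longrightarrow> q \<in> v"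
  shows "PBox q \<in> w"
proof -
  have "PImp p q \<in> S5" using assms(3) by (intro S5_by_mcs) (auto simp: mcs_simps)
  then have "PImp (PBox p) (PBox q) \<in> S5" by (meson S5.K S5.MP S5.Nec)
  then show ?thesis using assms(1,2) mcs_S5 mcs_PImp by blast
qed

lemma mcs_T: "mcs w \<Longrightarrow> PBox p \<in> w \<Longrightarrow> p \<in> w"
  using mcs_S5[OF _ S5.T] mcs_PImp by blast

text \<open>Negative introspection, obtained from \<open>Five\<close> for the negation of
  \<open>p\<close>. The uses of \<open>mcs_box_mono\<close> handle the double negations under boxes
  that the encoding of \<open>PDia\<close> produces.\<close>

lemma mcs_box_neg_box: 
  assumes w: "mcs w" and "PBox p \<notin> w"
  shows "PBox (PNeg (PBox p)) \<in> w"
proof -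
  have "PBox (PNeg (PNeg p)) \<notin> w"
    using mcs_box_mono[OF w, of "PNeg (PNeg p)" p] assms(2) by (auto simp: mcs_simps)
  then have "PDia (PNeg p) \<in> w" using w by (simp add: mcs_simps)
  then have "PBox (PDia (PNeg p)) \<in> w" using mcs_S5[OF w S5.Five] mcs_PImp[OF w] by blast
  then show ?thesis
  proof (rule mcs_box_mono[OF w])
    fix v assume v: "mcs v" "PDia (PNeg p) \<in> v"
    then show "PNeg (PBox p) \<in> v"
      using mcs_box_mono[OF v(1), of p "PNeg (PNeg p)"] by (auto simp: mcs_simps)
  qed
qed

text \<open>Positive introspection. By \<open>T\<close>, the boxed formula is possible; by negative
  introspection this possibility is necessary; and the possibility of a boxed formula implies that
  formula, again by negative introspection.\<close>

lemma mcs_4: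
  assumes w: "mcs w" and p: "PBox p \<in> w"
  shows "PBox (PBox p) \<in> w"
proof -
  have "PNeg (PBox p) \<notin> w" using p w by (simp add: mcs_simps)
  then have "PBox (PNeg (PBox p)) \<notin> w" using mcs_T w by blast
  then have "PBox (PNeg (PBox (PNeg (PBox p)))) \<in> w" by (rule mcs_box_neg_box[OF w])
  then show ?thesis
    by (rule mcs_box_mono[OF w]) (metis mcs_box_neg_box mcs_PFls mcs_PImp)
qed

primrec atoms :: "pm \<Rightarrow> nat set" where
  "atoms (PAtom i) = {i}"
| "atoms PFls = {}"
| "atoms (PImp p q) = atoms p \<union> atoms q"
| "atoms (PBox p) = atoms p"

lemma finite_atoms: "finite (atoms p)"
  by (induction p) auto

text \<open>In a universal frame a world matters only through the set of atoms that it makes true.\<close>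

primrec holds :: "nat set set \<Rightarrow> nat set \<Rightarrow> pm \<Rightarrow> bool" where
  "holds W v (PAtom i) = (i \<in> v)"
| "holds W v PFls = False"
| "holds W v (PImp p q) = (holds W v p \<longrightarrow> holds W v q)"
| "holds W v (PBox p) = (\<forall>u\<in>W. holds W u p)"

text \<open>The countermodel is the cluster of \<open>w\<close> in the canonical model, collapsed
  along \<open>val\<close> to sets of atoms of \<open>p\<close>, of which there are finitely
  many.\<close>

theorem S5_finite_model:
  assumes "p \<notin> S5"
  obtains W v where "finite W" "v \<in> W" "\<not> holds W v p"
proof -
  obtain w where w: "mcs w" "p \<notin> w" using S5_by_mcs assms by blast
  define U where "U = {u. mcs u \<and> (\<forall>q. PBox q \<in> u \<longleftrightarrow> PBox q \<in> w)}"
  have exists: "\<exists>u\<in>U. q \<notin> u" if q: "PBox q \<notin> w" for q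
  proof -
    \<comment> \<open>\<open>B\<close> consists of the boxed and negated boxed formulas that are
      necessary at \<open>w\<close>. By \<open>mcs_4\<close> and \<open>mcs_box_neg_box\<close> it
      fixes the status of every boxed formula, so each maximal consistent extension belongs to
      \<open>U\<close>.\<close>
    define B where "B = {r. PBox r \<in> w \<and> ((\<exists>s. r = PBox s) \<or> (\<exists>s. r = PNeg (PBox s)))}"
    have "\<not> S5_deriv (insert (PNeg q) B) PFls"
    proof
      assume "S5_deriv (insert (PNeg q) B) PFls"
      then have "S5_deriv B (PNeg (PNeg q))" by (rule S5_deduction)
      then have "S5_deriv B q" by (meson S5.A3 S5_deriv.detach S5_deriv.axm)
      then have "S5_deriv (PBox ` B) (PBox q)" by (rule S5_deriv_box)
      then have "S5_deriv w (PBox q)" by (rule S5_deriv_mono) (auto simp: B_def)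
      then show False using q w mcs_closed by blast
    qed
    then obtain u where u: "mcs u" "insert (PNeg q) B \<subseteq> u" using mcs_extension by blast
    have "PBox r \<in> u \<longleftrightarrow> PBox r \<in> w" for r
    proof (cases "PBox r \<in> w")
      case True
      then have "PBox r \<in> B" using mcs_4 w(1) unfolding B_def by blast
      then show ?thesis using True u by auto
    next
      case False
      then have "PNeg (PBox r) \<in> B" using mcs_box_neg_box w(1) unfolding B_def by blast
      then have "PNeg (PBox r) \<in> u" using u by auto
      then show ?thesis using False u by (auto simp: mcs_simps)
    qed
    then show ?thesis using u unfolding U_def by (intro bexI[of _ u]) (auto simp: mcs_simps)
  qed
  define val where "val = (\<lambda>u. {i \<in> atoms p. PAtom i \<in> u})"
  have truth: "holds (val ` U) (val u) q \<longleftrightarrow> q \<in> u" if "u \<in> U" "atoms q \<subseteq> atoms p" for q u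
    using that
  proof (induction q arbitrary: u)
    case (PAtom i)
    then show ?case by (auto simp: val_def)
  next
    case PFls
    then show ?case by (auto simp: U_def mcs_simps)
  next
    case (PImp q r)
    then show ?case by (auto simp: U_def mcs_simps)
  next
    case (PBox q)
    have "(\<forall>u\<in>U. q \<in> u) \<longleftrightarrow> PBox q \<in> w"
      using exists[of q] mcs_T unfolding U_def by blast
    then show ?case using PBox unfolding U_def by auto
  qed
  show thesis
  proof
    have "val ` U \<subseteq> Pow (atoms p)" unfolding val_def by auto
    then show "finite (val ` U)" using finite_atoms finite_subset by blast
    have "w \<in> U" using w(1) unfolding U_def by blast
    then show "val w \<in> val ` U" "\<not> holds (val ` U) (val w) p" using truth w(2) by auto
  qed
qed

text \<open>If box \<open>p\<close> failed, negative introspection would make its failure necessary,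
  against its possibility; so box \<open>p\<close> holds, and \<open>T\<close> gives
  \<open>p\<close>. The converse direction applies S5 through this theorem only.\<close>

lemma S5_dia_box: "PImp (PDia (PBox p)) p \<in> S5"
proof (rule S5_by_mcs)
  fix w assume w: "mcs w"
  then show "PImp (PDia (PBox p)) p \<in> w"
    using mcs_box_neg_box[OF w, of p] mcs_T[OF w] by (auto simp: mcs_simps)
qed

section \<open>Set theory inside a model of ZFC\<close>

text \<open>Seen from outside, the model may be ill-founded. Induction, recursion and set formation
  in it are therefore restricted to predicates definable with parameters.\<close>

locale zfc =
  fixes E :: "'a \<Rightarrow> 'a \<Rightarrow> bool" (infix \<open>\<epsilon>\<close> 50)
  assumes ZFC: "\<phi> \<in> ZFC \<Longrightarrow> sat UNIV (\<epsilon>) e \<phi>"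
begin

subsection \<open>Definability with parameters\<close>

text \<open>A free variable of a defining formula stands for a variable of the environment (\<open>Inl\<close>) or for a
  parameter (\<open>Inr\<close>).\<close>

definition lookup :: "(nat \<Rightarrow> 'a) \<Rightarrow> nat + 'a \<Rightarrow> 'a" where
  "lookup e c = (case c of Inl j \<Rightarrow> e j | Inr a \<Rightarrow> a)"

definition dfn :: "((nat \<Rightarrow> 'a) \<Rightarrow> bool) \<Rightarrow> bool" where
  "dfn P \<longleftrightarrow> (\<exists>\<phi> r. \<forall>e. P e \<longleftrightarrow> sat UNIV (\<epsilon>) (\<lambda>i. lookup e (r i)) \<phi>)"

definition tm :: "((nat \<Rightarrow> 'a) \<Rightarrow> 'a) \<Rightarrow> bool" where
  "tm t \<longleftrightarrow> (\<exists>c. \<forall>e. t e = lookup e c)"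

lemma tm_var: "tm (\<lambda>e. e i)"
  unfolding tm_def lookup_def by (rule exI[of _ "Inl i"]) simp

lemma tm_const: "tm (\<lambda>e. a)"
  unfolding tm_def lookup_def by (rule exI[of _ "Inr a"]) simp

lemma dfn_sat: "dfn (\<lambda>e. sat UNIV (\<epsilon>) e \<phi>)"
  unfolding dfn_def by (rule exI[of _ \<phi>], rule exI[of _ Inl]) (simp add: lookup_def)

lemma dfn_subst:
  assumes "dfn P" "\<And>i. tm (t i)"
  shows "dfn (\<lambda>e. P (\<lambda>i. t i e))"
proof -
  obtain \<phi> r where P: "\<And>e. P e \<longleftrightarrow> sat UNIV (\<epsilon>) (\<lambda>i. lookup e (r i)) \<phi>"
    using assms(1) unfolding dfn_def by blast
  obtain c where c: "\<And>i e. t i e = lookup e (c i)"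
    using assms(2) unfolding tm_def by metis
  define q where "q = (\<lambda>i. case r i of Inl j \<Rightarrow> c j | Inr a \<Rightarrow> Inr a)"
  have "lookup (\<lambda>i. t i e) (r i) = lookup e (q i)" for i e
    unfolding q_def by (simp add: c lookup_def split: sum.split)
  then show ?thesis unfolding dfn_def P by (intro exI[of _ \<phi>] exI[of _ q]) simp
qed

lemma dfn_subst1: "dfn (\<lambda>e. P (e 0)) \<Longrightarrow> tm t \<Longrightarrow> dfn (\<lambda>e. P (t e))"
  using dfn_subst[of "\<lambda>e. P (e 0)" "\<lambda>_. t"] by simp

lemma dfn_subst2:
  assumes "dfn (\<lambda>e. P (e 0) (e (Suc 0)))" "tm t" "tm u"
  shows "dfn (\<lambda>e. P (t e) (u e))"
  using dfn_subst[OF assms(1), of "case_nat t (\<lambda>_. u)"] assms(2,3)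
  by (simp split: nat.split)

lemma dfn_subst3:
  assumes "dfn (\<lambda>e. P (e 0) (e (Suc 0)) (e (Suc (Suc 0))))" "tm t" "tm u" "tm v"
  shows "dfn (\<lambda>e. P (t e) (u e) (v e))"
  using dfn_subst[OF assms(1), of "case_nat t (case_nat u (\<lambda>_. v))"] assms(2-)
  by (simp split: nat.split)

lemma dfn_mem: "tm t \<Longrightarrow> tm u \<Longrightarrow> dfn (\<lambda>e. t e \<epsilon> u e)"
  using dfn_subst2[of "(\<epsilon>)"] dfn_sat[of "0 \<^bold>\<in> Suc 0"] by simp

lemma dfn_eq: "tm t \<Longrightarrow> tm u \<Longrightarrow> dfn (\<lambda>e. t e = u e)"
  using dfn_subst2[of "(=)"] dfn_sat[of "0 \<^bold>= Suc 0"] by simp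

lemma dfn_False: "dfn (\<lambda>e. False)"
  using dfn_sat[of "\<^bold>\<bottom>"] by simp

lemma dfn_imp:
  assumes "dfn P" "dfn Q"
  shows "dfn (\<lambda>e. P e \<longrightarrow> Q e)"
proof -
  obtain \<phi> r where P: "\<And>e. P e \<longleftrightarrow> sat UNIV (\<epsilon>) (\<lambda>i. lookup e (r i)) \<phi>"
    using assms(1) unfolding dfn_def by blast
  obtain \<psi> q where Q: "\<And>e. Q e \<longleftrightarrow> sat UNIV (\<epsilon>) (\<lambda>i. lookup e (q i)) \<psi>"
    using assms(2) unfolding dfn_def by blast
  \<comment> \<open>Even variables serve the first formula and odd ones the second, so that the two
    lists of parameters do not clash.\<close>
  let ?r = "\<lambda>i. if even i then r (i div 2) else q (i div 2)"
  let ?\<chi> = "rename (\<lambda>i. 2 * i) \<phi> \<^bold>\<longrightarrow> rename (\<lambda>i. 2 * i + 1) \<psi>"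
  show ?thesis
    unfolding dfn_def P Q by (intro exI[of _ ?\<chi>] exI[of _ ?r]) (simp add: sat_rename)
qed

lemma dfn_all:
  assumes "dfn (\<lambda>e. Q (e 0) (\<lambda>i. e (Suc i)))"
  shows "dfn (\<lambda>e. \<forall>x. Q x e)"
proof -
  obtain \<phi> r where P: "\<And>e. Q (e 0) (\<lambda>i. e (Suc i)) \<longleftrightarrow> sat UNIV (\<epsilon>) (\<lambda>i. lookup e (r i)) \<phi>"
    using assms(1) unfolding dfn_def by blast
  have Q: "Q x e \<longleftrightarrow> sat UNIV (\<epsilon>) (\<lambda>i. lookup (case_nat x e) (r i)) \<phi>" for x e
    using P[of "case_nat x e"] by simp
  \<comment> \<open>Exactly the variables that read environment entry 0 become bound. The others
    move up past the binder and their entries drop by one; the value of \<open>q\<close> at a bound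
    variable is never read.\<close>
  define s where "s = (\<lambda>i. if r i = Inl 0 then 0 else Suc i)"
  define q where "q = (\<lambda>i. case r i of Inl j \<Rightarrow> Inl (j - 1) | Inr a \<Rightarrow> Inr a)"
  have "lookup (case_nat x e) (r i) = case_nat x (\<lambda>i. lookup e (q i)) (s i)" for x e i
    unfolding s_def q_def lookup_def by (auto split: sum.split nat.split)
  then show ?thesis
    unfolding dfn_def Q
    by (intro exI[of _ "\<^bold>\<forall>(rename s \<phi>)"] exI[of _ q]) (simp add: sat_rename)
qed

lemma dfn_not: "dfn P \<Longrightarrow> dfn (\<lambda>e. \<not> P e)"
  using dfn_imp[OF _ dfn_False] by simp

lemma dfn_and: "dfn P \<Longrightarrow> dfn Q \<Longrightarrow> dfn (\<lambda>e. P e \<and> Q e)"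
  using dfn_not[OF dfn_imp[OF _ dfn_not], of P Q] by simp

lemma dfn_or: "dfn P \<Longrightarrow> dfn Q \<Longrightarrow> dfn (\<lambda>e. P e \<or> Q e)"
  using dfn_imp[OF dfn_not, of P Q] by (simp add: disj_imp)

lemma dfn_iff: "dfn P \<Longrightarrow> dfn Q \<Longrightarrow> dfn (\<lambda>e. P e \<longleftrightarrow> Q e)"
  using dfn_and[OF dfn_imp dfn_imp, of P Q Q P] by (simp add: iff_conv_conj_imp)

lemma dfn_ex: "dfn (\<lambda>e. Q (e 0) (\<lambda>i. e (Suc i))) \<Longrightarrow> dfn (\<lambda>e. \<exists>x. Q x e)"
  using dfn_not[OF dfn_all[OF dfn_not], of Q] by simp

text \<open>With these rules \<open>intro\<close> proves definability along the structure of a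
  predicate, so that no formula has to be written out for Separation, Replacement and
  induction.\<close>

lemmas dfn_intros = tm_var tm_const dfn_mem dfn_eq dfn_imp dfn_all dfn_not dfn_and dfn_or dfn_iff dfn_ex

subsection \<open>The axioms\<close>

lemma fv_All_pow: "fv ((All ^^ n) \<phi>) = {i. i + n \<in> fv \<phi>}"
  by (induction n) auto

lemma All_closure: "\<exists>n. fv ((All ^^ n) \<phi>) = {}"
proof -
  obtain n where "\<forall>i\<in>fv \<phi>. i < n" using finite_fv finite_nat_set_iff_bounded by blast
  then show ?thesis unfolding fv_All_pow by (intro exI[of _ n]) fastforce
qed

lemma sat_All_pow: "(\<forall>e. sat UNIV (\<epsilon>) e ((All ^^ n) \<phi>)) \<longleftrightarrow> (\<forall>e. sat UNIV (\<epsilon>) e \<phi>)"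
proof (induction n)
  case (Suc n)
  have "(\<forall>e. sat UNIV (\<epsilon>) e (\<^bold>\<forall>\<psi>)) \<longleftrightarrow> (\<forall>e. sat UNIV (\<epsilon>) e \<psi>)" for \<psi>
  proof
    assume A: "\<forall>e. sat UNIV (\<epsilon>) e (\<^bold>\<forall>\<psi>)"
    show "\<forall>e. sat UNIV (\<epsilon>) e \<psi>"
    proof
      fix e :: "nat \<Rightarrow> 'a"
      have "case_nat (e 0) (\<lambda>i. e (Suc i)) = e" by (auto split: nat.split)
      then show "sat UNIV (\<epsilon>) e \<psi>" using A by (metis UNIV_I sat.simps(5))
    qed
  qed simp
  then show ?case using Suc by simp
qed simp

text \<open>\<open>ZFC\<close> contains the instances in closed form. A long enough block of
  universal quantifiers closes the instance, and \<open>sat_All_pow\<close> strips it off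
  again.\<close>

lemma sat_separation: "sat UNIV (\<epsilon>) e (separation \<phi>)"
proof -
  obtain n where "fv ((All ^^ n) (separation \<phi>)) = {}" using All_closure by blast
  then have "(All ^^ n) (separation \<phi>) \<in> ZFC" unfolding ZFC_def by blast
  then show ?thesis using ZFC sat_All_pow by metis
qed

lemma sat_replacement: "sat UNIV (\<epsilon>) e (replacement \<phi>)"
proof -
  obtain n where "fv ((All ^^ n) (replacement \<phi>)) = {}" using All_closure by blast
  then have "(All ^^ n) (replacement \<phi>) \<in> ZFC" unfolding ZFC_def by blast
  then show ?thesis using ZFC sat_All_pow by metis
qed

lemma ext: "(\<And>z. z \<epsilon> x \<longleftrightarrow> z \<epsilon> y) \<Longrightarrow> x = y"
  using ZFC[of extensionality, unfolded extensionality_def]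
  by (simp add: ZFC_def extensionality_def eval_nat_numeral)

lemma foundation_ex: "y \<epsilon> x \<Longrightarrow> \<exists>y. y \<epsilon> x \<and> (\<forall>z. z \<epsilon> y \<longrightarrow> \<not> z \<epsilon> x)"
  using ZFC[of foundation] by (simp add: ZFC_def foundation_def eval_nat_numeral) blast

lemma upair_ex: "\<exists>p. \<forall>z. z \<epsilon> p \<longleftrightarrow> z = x \<or> z = y"
proof -
  have "sat UNIV (\<epsilon>) e pairing" for e by (simp add: ZFC ZFC_def)
  then show ?thesis
    unfolding pairing_def sat.simps(5) sat_connectives(3) sat_Iff
    by (simp add: eval_nat_numeral disj_imp)
qed

lemma union_ex: "\<exists>u. \<forall>z. z \<epsilon> u \<longleftrightarrow> (\<exists>y. y \<epsilon> x \<and> z \<epsilon> y)"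
proof -
  have "sat UNIV (\<epsilon>) e union_ax" for e by (simp add: ZFC ZFC_def)
  then show ?thesis
    unfolding union_ax_def sat.simps(5) sat_connectives(3) sat_Iff
    by (simp add: eval_nat_numeral)
qed

definition sub :: "'a \<Rightarrow> 'a \<Rightarrow> bool" where
  "sub x y \<longleftrightarrow> (\<forall>z. z \<epsilon> x \<longrightarrow> z \<epsilon> y)"

lemma sat_subset_fm: "sat UNIV (\<epsilon>) e (subset_fm x y) \<longleftrightarrow> sub (e x) (e y)"
  by (simp add: subset_fm_def sub_def)

lemma pow_ex: "\<exists>p. \<forall>z. z \<epsilon> p \<longleftrightarrow> sub z x"
proof -
  have "sat UNIV (\<epsilon>) e powerset" for e by (simp add: ZFC ZFC_def)
  then show ?thesis
    unfolding powerset_def sat.simps(5) sat_connectives(3) sat_Iff sat_subset_fm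
    by (simp add: eval_nat_numeral)
qed

lemma separation_ex:
  assumes "dfn (\<lambda>e. P (e 0))"
  shows "\<exists>b. \<forall>z. z \<epsilon> b \<longleftrightarrow> z \<epsilon> a \<and> P z"
proof -
  obtain \<phi> r where P: "\<And>e. P (e 0) \<longleftrightarrow> sat UNIV (\<epsilon>) (\<lambda>i. lookup e (r i)) \<phi>"
    using assms unfolding dfn_def by blast
  \<comment> \<open>Since \<open>P\<close> looks at a single entry, the environment may be taken
    constantly equal to \<open>z\<close>; every environment variable then becomes variable 0.
    Parameters go to \<open>i + 2\<close>, past the place of the ambient set, and the undefined
    values of \<open>c\<close> are never read.\<close>
  define s where "s = (\<lambda>i. case r i of Inl j \<Rightarrow> 0 | Inr a \<Rightarrow> i + 2)"
  define c where "c = (\<lambda>i. case r i of Inl j \<Rightarrow> undefined | Inr a \<Rightarrow> a)"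
  have 1: "lookup (\<lambda>_. z) (r i) = case_nat z (case_nat b (case_nat a c)) (case_nat 0 (\<lambda>i. i + 2) (s i))"
    for z b a i
    unfolding s_def c_def lookup_def by (auto split: sum.split)
  have 2: "P z \<longleftrightarrow> sat UNIV (\<epsilon>) (case_nat z (case_nat b (case_nat a c)))
      (rename (case_nat 0 (\<lambda>i. i + 2)) (rename s \<phi>))" for z b a
    using P[of "\<lambda>_. z"] unfolding sat_rename 1[of z _ b a] by simp
  have "sat UNIV (\<epsilon>) c (separation (rename s \<phi>))" by (rule sat_separation)
  then show ?thesis
    unfolding separation_def sat.simps(5) sat_connectives(3) sat_Iff
    unfolding sat_connectives(1) 2[symmetric]
    by (simp add: eval_nat_numeral)
qed

lemma replacement_ex:
  assumes "dfn (\<lambda>e. R (e 0) (e (Suc 0)))"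
    and "\<And>x y y'. x \<epsilon> a \<Longrightarrow> R x y \<Longrightarrow> R x y' \<Longrightarrow> y = y'"
  shows "\<exists>b. \<forall>y. y \<epsilon> b \<longleftrightarrow> (\<exists>x. x \<epsilon> a \<and> R x y)"
proof -
  obtain \<phi> r where R: "\<And>e. R (e 0) (e (Suc 0)) \<longleftrightarrow> sat UNIV (\<epsilon>) (\<lambda>i. lookup e (r i)) \<phi>"
    using assms unfolding dfn_def by blast
  \<comment> \<open>\<open>R\<close> has its argument \<open>x\<close> first, while
    \<open>replacement\<close> puts the value \<open>y\<close> at variable 0; hence the swap of 0
    and 1. Variable 2 is the domain \<open>a\<close>, so parameters start at 3.\<close>
  define s where "s = (\<lambda>i. case r i of Inl j \<Rightarrow> if j = 0 then 1 else 0 | Inr a \<Rightarrow> i + 3)"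
  define c where "c = (\<lambda>i. case r i of Inl j \<Rightarrow> undefined | Inr a \<Rightarrow> a)"
  define \<psi> where "\<psi> = rename s \<phi>"
  have R': "R x y \<longleftrightarrow> sat UNIV (\<epsilon>) e \<psi>"
    if "e 0 = y" "e (Suc 0) = x" "\<And>i. e (i + 3) = c i" for x y e
  proof -
    have "lookup (case_nat x (\<lambda>_. y)) (r i) = e (s i)" for i
      using that unfolding s_def c_def lookup_def
      by (auto split: sum.split nat.split)
    then show ?thesis
      using R[of "case_nat x (\<lambda>_. y)"] unfolding \<psi>_def sat_rename by simp
  qed
  have 1: "sat UNIV (\<epsilon>) (case_nat y' (case_nat y (case_nat x (case_nat a c))))
       (rename Suc \<psi>) \<longleftrightarrow> R x y" for x y y'
    unfolding sat_rename by (rule R'[symmetric]) (simp_all add: eval_nat_numeral)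
  have 2: "sat UNIV (\<epsilon>) (case_nat y' (case_nat y (case_nat x (case_nat a c))))
       (rename (case_nat 0 (\<lambda>i. i + 2)) \<psi>) \<longleftrightarrow> R x y'" for x y y'
    unfolding sat_rename by (rule R'[symmetric]) (simp_all add: eval_nat_numeral)
  have 3: "sat UNIV (\<epsilon>) (case_nat x (case_nat y (case_nat b (case_nat a c))))
       (rename (case_nat 1 (case_nat 0 (\<lambda>i. i + 3))) \<psi>) \<longleftrightarrow> R x y" for x y b
    unfolding sat_rename by (rule R'[symmetric]) (simp_all add: eval_nat_numeral)
  let ?H = "\<^bold>\<forall>(0 \<^bold>\<in> 1 \<^bold>\<longrightarrow> \<^bold>\<forall>(\<^bold>\<forall>(
        rename Suc \<psi> \<^bold>\<and> rename (case_nat 0 (\<lambda>i. i + 2)) \<psi> \<^bold>\<longrightarrow> 1 \<^bold>= 0)))"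
  let ?C = "\<^bold>\<exists>(\<^bold>\<forall>(0 \<^bold>\<in> 1 \<^bold>\<longleftrightarrow>
        \<^bold>\<exists>(0 \<^bold>\<in> 3 \<^bold>\<and> rename (case_nat 1 (case_nat 0 (\<lambda>i. i + 3))) \<psi>)))"
  have "sat UNIV (\<epsilon>) c (\<^bold>\<forall>(?H \<^bold>\<longrightarrow> ?C))"
    using sat_replacement unfolding replacement_def by blast
  then have "sat UNIV (\<epsilon>) (case_nat a c) ?H \<longrightarrow> sat UNIV (\<epsilon>) (case_nat a c) ?C"
    unfolding sat.simps(5)[of _ _ c] sat.simps(4)[of _ _ _ ?H] by blast
  moreover have "sat UNIV (\<epsilon>) (case_nat a c) ?H"
    unfolding sat.simps(4,5) sat_connectives(1) 1 2 using assms(2) by simp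
  moreover have "sat UNIV (\<epsilon>) (case_nat a c) ?C \<longleftrightarrow> (\<exists>b. \<forall>y. y \<epsilon> b \<longleftrightarrow> (\<exists>x. x \<epsilon> a \<and> R x y))"
    unfolding sat.simps(5) sat_connectives(3) sat_Iff
    unfolding sat_connectives(1) 3 by (simp add: eval_nat_numeral)
  ultimately show ?thesis by blast
qed

subsection \<open>Basic constructions\<close>

definition Coll :: "('a \<Rightarrow> bool) \<Rightarrow> 'a" where
  "Coll P = (THE b. \<forall>z. z \<epsilon> b \<longleftrightarrow> P z)"

lemma in_Coll:
  assumes "\<exists>b. \<forall>z. z \<epsilon> b \<longleftrightarrow> P z"
  shows "z \<epsilon> Coll P \<longleftrightarrow> P z"
proof -
  have "\<exists>!b. \<forall>z. z \<epsilon> b \<longleftrightarrow> P z" using assms by (auto intro: ext)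
  from theI'[OF this] show ?thesis unfolding Coll_def by blast
qed

definition emp :: 'a where
  "emp = Coll (\<lambda>_. False)"

lemma not_in_emp [simp]: "\<not> z \<epsilon> emp"
proof -
  have "\<exists>b. \<forall>z. z \<epsilon> b \<longleftrightarrow> z \<epsilon> undefined \<and> False"
    by (rule separation_ex) (rule dfn_False)
  then show ?thesis unfolding emp_def using in_Coll[of "\<lambda>_. False"] by simp
qed

definition up :: "'a \<Rightarrow> 'a \<Rightarrow> 'a" where
  "up x y = Coll (\<lambda>z. z = x \<or> z = y)"

lemma in_up [simp]: "z \<epsilon> up x y \<longleftrightarrow> z = x \<or> z = y"
  unfolding up_def by (rule in_Coll[OF upair_ex])

definition bigcup :: "'a \<Rightarrow> 'a" where
  "bigcup x = Coll (\<lambda>z. \<exists>y. y \<epsilon> x \<and> z \<epsilon> y)"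

lemma in_bigcup [simp]: "z \<epsilon> bigcup x \<longleftrightarrow> (\<exists>y. y \<epsilon> x \<and> z \<epsilon> y)"
  unfolding bigcup_def by (rule in_Coll[OF union_ex])

definition cup :: "'a \<Rightarrow> 'a \<Rightarrow> 'a" where
  "cup x y = bigcup (up x y)"

lemma in_cup [simp]: "z \<epsilon> cup x y \<longleftrightarrow> z \<epsilon> x \<or> z \<epsilon> y"
  unfolding cup_def by auto

definition S :: "'a \<Rightarrow> 'a" where
  "S x = cup x (up x x)"

lemma in_S [simp]: "z \<epsilon> S x \<longleftrightarrow> z \<epsilon> x \<or> z = x"
  unfolding S_def by auto

lemma not_mem_self [simp]: "\<not> x \<epsilon> x"
  using foundation_ex[of x "up x x"] by auto

text \<open>A relational form beside the function \<open>S\<close>, because \<open>tm\<close> admits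
  variables and parameters but no compound terms.\<close>

definition is_succ :: "'a \<Rightarrow> 'a \<Rightarrow> bool" where
  "is_succ s x \<longleftrightarrow> (\<forall>z. z \<epsilon> s \<longleftrightarrow> z \<epsilon> x \<or> z = x)"

lemma is_succ_iff [simp]: "is_succ s x \<longleftrightarrow> s = S x"
  unfolding is_succ_def using ext by auto

lemma sat_succ_fm: "sat UNIV (\<epsilon>) e (succ_fm s x) \<longleftrightarrow> is_succ (e s) (e x)"
  unfolding succ_fm_def is_succ_def sat.simps(5) sat_Iff by (simp add: disj_commute disj_imp)

lemma dfn_is_succ: "tm t \<Longrightarrow> tm u \<Longrightarrow> dfn (\<lambda>e. is_succ (t e) (u e))"
  by (rule dfn_subst2[of is_succ]) (use dfn_sat[of "succ_fm 0 (Suc 0)"] in \<open>simp_all only: sat_succ_fm\<close>)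

lemma dfn_sub: "tm t \<Longrightarrow> tm u \<Longrightarrow> dfn (\<lambda>e. sub (t e) (u e))"
  by (rule dfn_subst2[of sub]) (use dfn_sat[of "subset_fm 0 (Suc 0)"] in \<open>simp_all only: sat_subset_fm\<close>)

subsection \<open>Ordinals\<close>

definition transitive :: "'a \<Rightarrow> bool" where
  "transitive x \<longleftrightarrow> (\<forall>y. y \<epsilon> x \<longrightarrow> sub y x)"

definition ord :: "'a \<Rightarrow> bool" where
  "ord x \<longleftrightarrow> transitive x \<and> (\<forall>y. y \<epsilon> x \<longrightarrow> transitive y)"

lemma sat_ord_fm: "sat UNIV (\<epsilon>) e (ord_fm x) \<longleftrightarrow> ord (e x)"
  unfolding ord_fm_def transitive_fm_def ord_def transitive_def
  by (simp add: sat_subset_fm)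

lemma dfn_ord: "tm t \<Longrightarrow> dfn (\<lambda>e. ord (t e))"
  by (rule dfn_subst1[of ord]) (use dfn_sat[of "ord_fm 0"] in \<open>simp_all only: sat_ord_fm\<close>)

lemmas dfn_more = dfn_intros dfn_is_succ dfn_sub dfn_ord

lemma transitiveD: "transitive x \<Longrightarrow> y \<epsilon> x \<Longrightarrow> z \<epsilon> y \<Longrightarrow> z \<epsilon> x"
  unfolding transitive_def sub_def by blast

lemma ord_trans: "ord a \<Longrightarrow> b \<epsilon> a \<Longrightarrow> c \<epsilon> b \<Longrightarrow> c \<epsilon> a"
  unfolding ord_def using transitiveD by blast

lemma ord_mem: "ord a \<Longrightarrow> b \<epsilon> a \<Longrightarrow> ord b"
  unfolding ord_def using transitiveD by blast

lemma ord_S: "ord a \<Longrightarrow> ord (S a)"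
  unfolding ord_def transitive_def sub_def in_S by blast

lemma ord_bigcup: "(\<And>b. b \<epsilon> A \<Longrightarrow> ord b) \<Longrightarrow> ord (bigcup A)"
  unfolding ord_def transitive_def sub_def in_bigcup by blast

lemma ord_induct [consumes 2, case_names step]:
  assumes "dfn (\<lambda>e. P (e 0))" "ord a"
    and step: "\<And>a. ord a \<Longrightarrow> (\<And>b. b \<epsilon> a \<Longrightarrow> P b) \<Longrightarrow> P a"
  shows "P a"
proof (rule ccontr)
  assume "\<not> P a"
  \<comment> \<open>\<open>S a\<close> in place of \<open>a\<close> makes \<open>a\<close> itself a
    member of the set of counterexamples.\<close>
  obtain B where B: "\<And>z. z \<epsilon> B \<longleftrightarrow> z \<epsilon> S a \<and> \<not> P z"
    using separation_ex[of "\<lambda>z. \<not> P z" "S a"] dfn_not[OF assms(1)] by blast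
  have "a \<epsilon> B" using \<open>\<not> P a\<close> B by simp
  then obtain b where b: "b \<epsilon> B" "\<And>z. z \<epsilon> b \<Longrightarrow> \<not> z \<epsilon> B" using foundation_ex by blast
  have "ord (S a)" using assms(2) by (rule ord_S)
  then have "ord b" "\<And>z. z \<epsilon> b \<Longrightarrow> z \<epsilon> S a" using b(1) B ord_mem ord_trans by blast+
  then show False using step[of b] b B by blast
qed

lemma ord_least:
  assumes "dfn (\<lambda>e. P (e 0))" "ord a" "P a"
  shows "\<exists>b. ord b \<and> P b \<and> (\<forall>c. c \<epsilon> b \<longrightarrow> \<not> P c)"
  using ord_induct[of "\<lambda>x. \<not> P x", OF dfn_not[OF assms(1)] assms(2)] assms(3) by blast

text \<open>A double induction. If \<open>a\<close> and \<open>b\<close> are incomparable, the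
  induction hypotheses put each element of one into the other, and Extensionality makes them
  equal.\<close>

lemma ord_linear:
  assumes "ord a" "ord b"
  shows "a \<epsilon> b \<or> a = b \<or> b \<epsilon> a"
proof -
  have "dfn (\<lambda>e. \<forall>b. ord b \<longrightarrow> e 0 \<epsilon> b \<or> e 0 = b \<or> b \<epsilon> e 0)"
    by (intro dfn_more)
  then have "\<forall>b. ord b \<longrightarrow> a \<epsilon> b \<or> a = b \<or> b \<epsilon> a" using assms(1)
  proof (induction rule: ord_induct)
    case (step a)
    have "b \<epsilon> a \<or> a = b \<or> a \<epsilon> b" if "ord b" for b
    proof -
      have "dfn (\<lambda>e. e 0 \<epsilon> a \<or> a = e 0 \<or> a \<epsilon> e 0)" by (intro dfn_more)
      then show ?thesis using that
      proof (induction rule: ord_induct)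
        case (step b)
        show ?case
        proof (rule ccontr)
          assume *: "\<not> (b \<epsilon> a \<or> a = b \<or> a \<epsilon> b)"
          have "y \<epsilon> b" if "y \<epsilon> a" for y
            using \<open>\<And>b. b \<epsilon> a \<Longrightarrow> _ b\<close>[OF that] \<open>ord a\<close> \<open>ord b\<close> * that ord_trans by blast
          moreover have "y \<epsilon> a" if "y \<epsilon> b" for y
            using step.IH[OF that] \<open>ord b\<close> * that ord_trans by blast
          ultimately show False using * ext by blast
        qed
      qed
    qed
    then show ?case by blast
  qed
  then show ?thesis using assms(2) by blast
qed

definition le :: "'a \<Rightarrow> 'a \<Rightarrow> bool" where
  "le a b \<longleftrightarrow> a \<epsilon> b \<or> a = b"

lemma sub_imp_le: "ord a \<Longrightarrow> ord b \<Longrightarrow> sub a b \<Longrightarrow> le a b"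
  using ord_linear unfolding le_def sub_def by (metis not_mem_self)

lemma le_trans: "ord c \<Longrightarrow> le a b \<Longrightarrow> le b c \<Longrightarrow> le a c"
  unfolding le_def using ord_trans by blast

lemma le_refl [simp]: "le a a"
  unfolding le_def by simp

text \<open>Take the union of the ordinals in an inductive set. It provides the length of the
  iteration in \<open>transitive_superset\<close>.\<close>

lemma limit_ex: "\<exists>l. ord l \<and> emp \<epsilon> l \<and> (\<forall>a. a \<epsilon> l \<longrightarrow> S a \<epsilon> l)"
proof -
  have "sat UNIV (\<epsilon>) e infinity" for e by (simp add: ZFC ZFC_def)
  then obtain I z where I: "z \<epsilon> I" "\<forall>x. \<not> x \<epsilon> z" "\<forall>x. x \<epsilon> I \<longrightarrow> (\<exists>s. s \<epsilon> I \<and> is_succ s x)"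
    unfolding infinity_def sat_succ_fm[symmetric]
    by (auto simp: sat_succ_fm eval_nat_numeral simp del: is_succ_iff)
  have z: "z = emp" using I(2) by (intro ext) simp
  obtain Os where Os: "\<And>a. a \<epsilon> Os \<longleftrightarrow> a \<epsilon> I \<and> ord a"
    using separation_ex[of ord I] dfn_ord[OF tm_var] by blast
  have ord_O: "ord (bigcup Os)" using Os by (intro ord_bigcup) blast
  have S: "S a \<epsilon> Os" if "a \<epsilon> Os" for a using that I(3) Os ord_S by auto
  have "ord emp" unfolding ord_def transitive_def by simp
  then have "emp \<epsilon> Os" using I(1) Os z by simp
  then have "emp \<epsilon> bigcup Os" using S by fastforce
  moreover have "S a \<epsilon> bigcup Os" if a: "a \<epsilon> bigcup Os" for a
  proof -
    obtain b where b: "a \<epsilon> b" "b \<epsilon> Os" using a by auto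
    then have "ord b" using Os by blast
    then have "ord (S a)" using b(1) ord_mem ord_S by blast
    moreover have "sub (S a) b" unfolding sub_def using b(1) \<open>ord b\<close> ord_trans by auto
    ultimately have "le (S a) b" using sub_imp_le \<open>ord b\<close> by blast
    then have "S a \<epsilon> S b" unfolding le_def by simp
    then show ?thesis using S[OF b(2)] by auto
  qed
  ultimately show ?thesis using ord_O by blast
qed

subsection \<open>Ordered pairs and functions\<close>

definition pr :: "'a \<Rightarrow> 'a \<Rightarrow> 'a" where
  "pr x y = up (up x x) (up x y)"

lemma up_eq_iff: "up x y = up x' y' \<longleftrightarrow> x = x' \<and> y = y' \<or> x = y' \<and> y = x'"
proof
  assume "up x y = up x' y'"
  then show "x = x' \<and> y = y' \<or> x = y' \<and> y = x'" by (metis in_up)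
next
  assume "x = x' \<and> y = y' \<or> x = y' \<and> y = x'"
  then show "up x y = up x' y'" by (intro ext) auto
qed

lemma pr_eq_iff [simp]: "pr x y = pr x' y' \<longleftrightarrow> x = x' \<and> y = y'"
  unfolding pr_def up_eq_iff by metis

definition is_pair :: "'a \<Rightarrow> 'a \<Rightarrow> 'a \<Rightarrow> bool" where
  "is_pair p x y \<longleftrightarrow> p = pr x y"

lemma sat_upair_fm: "sat UNIV (\<epsilon>) e (upair_fm z x y) \<longleftrightarrow> e z = up (e x) (e y)"
proof -
  have "sat UNIV (\<epsilon>) e (upair_fm z x y) \<longleftrightarrow> (\<forall>w. w \<epsilon> e z \<longleftrightarrow> w = e x \<or> w = e y)"
    unfolding upair_fm_def sat.simps(5) sat_Iff by (simp add: disj_imp)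
  then show ?thesis using ext by auto
qed

lemma sat_pair_fm: "sat UNIV (\<epsilon>) e (pair_fm p x y) \<longleftrightarrow> is_pair (e p) (e x) (e y)"
proof -
  have "sat UNIV (\<epsilon>) e (pair_fm p x y) \<longleftrightarrow> (\<forall>w. w \<epsilon> e p \<longleftrightarrow> w = up (e x) (e x) \<or> w = up (e x) (e y))"
    unfolding pair_fm_def sat.simps(5) sat_Iff by (simp add: sat_upair_fm disj_imp)
  then show ?thesis unfolding is_pair_def pr_def using ext by auto
qed

lemma dfn_is_pair: "tm t \<Longrightarrow> tm u \<Longrightarrow> tm v \<Longrightarrow> dfn (\<lambda>e. is_pair (t e) (u e) (v e))"
  by (rule dfn_subst3[of is_pair])
    (use dfn_sat[of "pair_fm 0 (Suc 0) (Suc (Suc 0))"] in \<open>simp_all only: sat_pair_fm\<close>)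

definition app :: "'a \<Rightarrow> 'a \<Rightarrow> 'a \<Rightarrow> bool" where
  "app f x y \<longleftrightarrow> pr x y \<epsilon> f"

lemma sat_app_fm: "sat UNIV (\<epsilon>) e (app_fm f x y) \<longleftrightarrow> app (e f) (e x) (e y)"
  by (simp add: app_fm_def sat_pair_fm app_def is_pair_def)

lemma dfn_app: "tm t \<Longrightarrow> tm u \<Longrightarrow> tm v \<Longrightarrow> dfn (\<lambda>e. app (t e) (u e) (v e))"
  by (rule dfn_subst3[of app])
    (use dfn_sat[of "app_fm 0 (Suc 0) (Suc (Suc 0))"] in \<open>simp_all only: sat_app_fm\<close>)

definition func :: "'a \<Rightarrow> 'a \<Rightarrow> bool" where
  "func f d \<longleftrightarrow> (\<forall>p. p \<epsilon> f \<longrightarrow> (\<exists>x. x \<epsilon> d \<and> (\<exists>y. is_pair p x y))) \<and>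
     (\<forall>x. x \<epsilon> d \<longrightarrow> (\<exists>y. \<forall>y'. app f x y' \<longleftrightarrow> y' = y))"

lemma sat_function_fm: "sat UNIV (\<epsilon>) e (function_fm f d) \<longleftrightarrow> func (e f) (e d)"
proof -
  have "sat UNIV (\<epsilon>) e (\<^bold>\<forall>(0 \<^bold>\<in> Suc d \<^bold>\<longrightarrow> \<^bold>\<exists>(\<^bold>\<forall>(app_fm (f + 3) 2 0 \<^bold>\<longleftrightarrow> 0 \<^bold>= 1)))) \<longleftrightarrow>
     (\<forall>x. x \<epsilon> e d \<longrightarrow> (\<exists>y. \<forall>y'. app (e f) x y' \<longleftrightarrow> y' = y))"
    unfolding sat.simps(5) sat.simps(4)[of _ _ _ "0 \<^bold>\<in> Suc d"] sat_connectives(3) sat_Iff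
    by (simp add: sat_app_fm eval_nat_numeral)
  then show ?thesis
    unfolding function_fm_def func_def sat_connectives(1) 
    by (simp add: sat_pair_fm eval_nat_numeral)
qed

lemma dfn_func: "tm t \<Longrightarrow> tm u \<Longrightarrow> dfn (\<lambda>e. func (t e) (u e))"
  by (rule dfn_subst2[of func])
    (use dfn_sat[of "function_fm 0 (Suc 0)"] in \<open>simp_all only: sat_function_fm\<close>)

lemmas dfn_all_intros = dfn_more dfn_is_pair dfn_app dfn_func

subsection \<open>Recursion along the ordinals\<close>

text \<open>The recursion \<open>v(\<alpha>) = x \<union> {z. \<exists>\<eta> < \<alpha>. Q z (v(\<eta>))}\<close> covers both the cumulative
  hierarchy and transitive closures.\<close>

definition recf :: "'a \<Rightarrow> ('a \<Rightarrow> 'a \<Rightarrow> bool) \<Rightarrow> 'a \<Rightarrow> 'a \<Rightarrow> bool" where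
  "recf x Q f d \<longleftrightarrow> func f d \<and> (\<forall>a. a \<epsilon> d \<longrightarrow> (\<forall>v. app f a v \<longrightarrow>
     (\<forall>z. z \<epsilon> v \<longleftrightarrow> z \<epsilon> x \<or> (\<exists>b. b \<epsilon> a \<and> (\<exists>u. app f b u \<and> Q z u)))))"

text \<open>The value at \<open>a\<close> is read off from an approximation on the successor of
  \<open>a\<close>. For \<open>x = emp\<close> and \<open>Q = sub\<close> this is the form of
  \<open>V_fm\<close>.\<close>

definition rval :: "'a \<Rightarrow> ('a \<Rightarrow> 'a \<Rightarrow> bool) \<Rightarrow> 'a \<Rightarrow> 'a \<Rightarrow> bool" where
  "rval x Q a v \<longleftrightarrow> (\<exists>s. is_succ s a \<and> (\<exists>f. recf x Q f s \<and> app f a v))"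

context
  fixes x :: 'a and Q :: "'a \<Rightarrow> 'a \<Rightarrow> bool"
  assumes Q_dfn: "dfn (\<lambda>e. Q (e 0) (e (Suc 0)))"
    and Q_set: "\<And>u. \<exists>s. \<forall>z. z \<epsilon> s \<longleftrightarrow> Q z u"
begin

lemma dfn_rval: "tm t \<Longrightarrow> tm u \<Longrightarrow> dfn (\<lambda>e. rval x Q (t e) (u e))"
proof (rule dfn_subst2[of "rval x Q"])
  show "dfn (\<lambda>e. rval x Q (e 0) (e (Suc 0)))"
    unfolding rval_def recf_def by (intro dfn_all_intros dfn_subst2[OF Q_dfn])
qed

lemma recf_value: "recf x Q f d \<Longrightarrow> a \<epsilon> d \<Longrightarrow> \<exists>!v. app f a v"
  unfolding recf_def func_def by metis

lemma recf_iff: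
  "recf x Q f d \<Longrightarrow> a \<epsilon> d \<Longrightarrow> app f a v \<Longrightarrow>
    z \<epsilon> v \<longleftrightarrow> z \<epsilon> x \<or> (\<exists>b. b \<epsilon> a \<and> (\<exists>u. app f b u \<and> Q z u))"
  unfolding recf_def by blast

lemma recf_unique:
  assumes f: "ord d" "recf x Q f d" "a \<epsilon> d" and f': "ord d'" "recf x Q f' d'" "a \<epsilon> d'"
  shows "app f a v \<longleftrightarrow> app f' a v"
proof -
  have "dfn (\<lambda>e. e 0 \<epsilon> d \<longrightarrow> e 0 \<epsilon> d' \<longrightarrow> (\<forall>v. app f (e 0) v \<longleftrightarrow> app f' (e 0) v))"
    by (intro dfn_all_intros)
  moreover have "ord a" using f ord_mem by blast
  ultimately have "a \<epsilon> d \<longrightarrow> a \<epsilon> d' \<longrightarrow> (\<forall>v. app f a v \<longleftrightarrow> app f' a v)"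
  proof (induction rule: ord_induct)
    case (step a)
    have "\<forall>v. app f a v \<longleftrightarrow> app f' a v" if a: "a \<epsilon> d" "a \<epsilon> d'"
    proof -
      have IH: "app f b u \<longleftrightarrow> app f' b u" if "b \<epsilon> a" for b u
        using step.IH[OF that] a that f(1) f'(1) ord_trans by blast
      obtain v where v: "app f a v" "\<And>w. app f a w \<Longrightarrow> w = v"
        using recf_value[OF f(2) a(1)] by blast
      obtain v' where v': "app f' a v'" "\<And>w. app f' a w \<Longrightarrow> w = v'"
        using recf_value[OF f'(2) a(2)] by blast
      have "v = v'"
        using recf_iff[OF f(2) a(1) v(1)] recf_iff[OF f'(2) a(2) v'(1)] IH
        by (intro ext) blast
      then show ?thesis using v v' by metis
    qed
    then show ?case by blast
  qed
  then show ?thesis using f f' by blast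
qed

lemma rval_iff: "rval x Q a v \<longleftrightarrow> (\<exists>f. recf x Q f (S a) \<and> app f a v)"
  unfolding rval_def by simp

lemma rval_unique: "ord a \<Longrightarrow> rval x Q a v \<Longrightarrow> rval x Q a v' \<Longrightarrow> v = v'"
  unfolding rval_iff using recf_unique[of "S a" _ a "S a"] recf_value[of _ "S a" a] ord_S
  by (metis in_S)

lemma rval_eq_app:
  assumes "ord d" "recf x Q f d" "a \<epsilon> d" "\<exists>u. rval x Q a u"
  shows "app f a v \<longleftrightarrow> rval x Q a v"
proof -
  have a: "ord a" using assms ord_mem by blast
  obtain f' u where f': "recf x Q f' (S a)" "app f' a u" using assms(4) rval_iff by blast
  have eq: "app f a w \<longleftrightarrow> app f' a w" for w
    using recf_unique[OF assms(1-3) ord_S[OF a] f'(1)] by simp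
  have "rval x Q a u" using f' rval_iff by blast
  moreover have "app f' a w \<longleftrightarrow> w = u" for w
    using recf_value[OF f'(1), of a] f'(2) by auto
  ultimately show ?thesis using eq rval_unique[OF a] by metis
qed

lemma rval_step:
  assumes "ord a" "rval x Q a v" "\<And>b. b \<epsilon> a \<Longrightarrow> \<exists>u. rval x Q b u"
  shows "z \<epsilon> v \<longleftrightarrow> z \<epsilon> x \<or> (\<exists>b. b \<epsilon> a \<and> (\<exists>u. rval x Q b u \<and> Q z u))"
proof -
  obtain f where f: "recf x Q f (S a)" "app f a v" using assms(2) rval_iff by blast
  have "app f b u \<longleftrightarrow> rval x Q b u" if "b \<epsilon> a" for b u
    using rval_eq_app[OF ord_S[OF assms(1)] f(1)] assms(3) that by simp
  then show ?thesis using recf_iff[OF f(1) _ f(2), of z] by auto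
qed

text \<open>By induction: Replacement collects the values below \<open>a\<close> into a function
  \<open>g\<close>, and one more pair extends it to an approximation on \<open>S a\<close>.\<close>

lemma rval_ex: "ord a \<Longrightarrow> \<exists>v. rval x Q a v"
proof -
  assume "ord a"
  have "dfn (\<lambda>e. \<exists>v. rval x Q (e 0) v)" by (intro dfn_all_intros dfn_rval)
  then show ?thesis using \<open>ord a\<close>
  proof (induction rule: ord_induct)
    case (step a)
    have ord: "ord b" if "b \<epsilon> a" for b using step.hyps that ord_mem by blast
    have "\<exists>g. \<forall>p. p \<epsilon> g \<longleftrightarrow> (\<exists>b. b \<epsilon> a \<and> (\<exists>v. rval x Q b v \<and> is_pair p b v))"
      using ord rval_unique
      by (intro replacement_ex) (intro dfn_all_intros dfn_rval, auto simp: is_pair_def)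
    then obtain g where g: "\<And>p. p \<epsilon> g \<longleftrightarrow> (\<exists>b. b \<epsilon> a \<and> (\<exists>v. rval x Q b v \<and> is_pair p b v))"
      by blast
    \<comment> \<open>\<open>A\<close> collects, for each value \<open>u\<close> below
      \<open>a\<close>, the set of all \<open>z\<close> with \<open>Q z u\<close>. Its union
      together with \<open>x\<close> is the value that the recursion prescribes at
      \<open>a\<close>.\<close>
    have "\<exists>A. \<forall>s. s \<epsilon> A \<longleftrightarrow> (\<exists>b. b \<epsilon> a \<and> (\<exists>v. rval x Q b v \<and> (\<forall>z. z \<epsilon> s \<longleftrightarrow> Q z v)))"
    proof (rule replacement_ex)
      show "dfn (\<lambda>e. \<exists>v. rval x Q (e 0) v \<and> (\<forall>z. z \<epsilon> e (Suc 0) \<longleftrightarrow> Q z v))"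
        by (intro dfn_all_intros dfn_rval dfn_subst2[OF Q_dfn])
      show "y = y'" if "b \<epsilon> a" "\<exists>v. rval x Q b v \<and> (\<forall>z. z \<epsilon> y \<longleftrightarrow> Q z v)"
        "\<exists>v. rval x Q b v \<and> (\<forall>z. z \<epsilon> y' \<longleftrightarrow> Q z v)" for b y y'
        using that ord rval_unique by (intro ext) blast
    qed
    then obtain A where
      A: "\<And>s. s \<epsilon> A \<longleftrightarrow> (\<exists>b. b \<epsilon> a \<and> (\<exists>v. rval x Q b v \<and> (\<forall>z. z \<epsilon> s \<longleftrightarrow> Q z v)))"
      by blast
    define v where "v = cup x (bigcup A)"
    have v: "z \<epsilon> v \<longleftrightarrow> z \<epsilon> x \<or> (\<exists>b. b \<epsilon> a \<and> (\<exists>u. rval x Q b u \<and> Q z u))" for z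
    proof -
      have "(\<exists>s. s \<epsilon> A \<and> z \<epsilon> s) \<longleftrightarrow> (\<exists>b. b \<epsilon> a \<and> (\<exists>u. rval x Q b u \<and> Q z u))"
        unfolding A using Q_set by metis
      then show ?thesis unfolding v_def by simp
    qed
    define f where "f = cup g (up (pr a v) (pr a v))"
    have app: "app f b u \<longleftrightarrow> b \<epsilon> a \<and> rval x Q b u \<or> b = a \<and> u = v" for b u
      unfolding f_def app_def by (simp add: g is_pair_def)
    have app_below: "app f b u \<longleftrightarrow> rval x Q b u" if "b \<epsilon> a" for b u
      using that by (auto simp: app)
    have "recf x Q f (S a)"
      unfolding recf_def
    proof (intro conjI allI impI)
      show "func f (S a)"
        unfolding func_def
      proof (intro conjI allI impI)
        fix p assume "p \<epsilon> f"
        then show "\<exists>b. b \<epsilon> S a \<and> (\<exists>y. is_pair p b y)"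
          unfolding f_def by (auto simp: g is_pair_def)
      next
        fix b assume "b \<epsilon> S a"
        then show "\<exists>y. \<forall>y'. app f b y' \<longleftrightarrow> y' = y"
          using step.IH ord rval_unique unfolding app in_S
          by (metis not_mem_self)
      qed
    next
      fix b w z assume b: "b \<epsilon> S a" "app f b w"
      have "z \<epsilon> w \<longleftrightarrow> z \<epsilon> x \<or> (\<exists>c. c \<epsilon> b \<and> (\<exists>u. rval x Q c u \<and> Q z u))"
      proof (cases "b = a")
        case True
        then show ?thesis using b v app by auto
      next
        case False
        then have "b \<epsilon> a" "rval x Q b w" using b app by auto
        then show ?thesis
          using rval_step[of b w z] ord step.IH step.hyps ord_trans by blast
      qed
      moreover have "rval x Q c u \<longleftrightarrow> app f c u" if "c \<epsilon> b" for c u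
        using app_below b(1) that step.hyps ord_trans unfolding in_S by blast
      ultimately show "z \<epsilon> w \<longleftrightarrow> z \<epsilon> x \<or> (\<exists>c. c \<epsilon> b \<and> (\<exists>u. app f c u \<and> Q z u))"
        by blast
    qed
    moreover have "app f a v" by (simp add: app)
    ultimately show ?case using rval_iff by blast
  qed
qed

lemma rval_mem:
  "ord a \<Longrightarrow> rval x Q a v \<Longrightarrow> z \<epsilon> v \<longleftrightarrow> z \<epsilon> x \<or> (\<exists>b. b \<epsilon> a \<and> (\<exists>u. rval x Q b u \<and> Q z u))"
  using rval_step rval_ex ord_mem by blast

end

text \<open>Iterate the union operation along a limit \<open>l\<close>. Every element of the result
  already occurs at a stage below \<open>l\<close>, so its members satisfy the recursion clause at
  \<open>l\<close>.\<close>

lemma transitive_superset: "\<exists>t. transitive t \<and> sub x t"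
proof -
  let ?Q = "\<lambda>z u. \<exists>w. w \<epsilon> u \<and> z \<epsilon> w"
  have Q: "dfn (\<lambda>e. ?Q (e 0) (e (Suc 0)))" "\<And>u. \<exists>s. \<forall>z. z \<epsilon> s \<longleftrightarrow> ?Q z u"
    by (intro dfn_all_intros) (rule union_ex)
  obtain l where l: "ord l" "emp \<epsilon> l" "\<And>a. a \<epsilon> l \<Longrightarrow> S a \<epsilon> l" using limit_ex by blast
  obtain t where t: "rval x ?Q l t" using rval_ex[OF Q l(1)] by blast
  note mem = rval_mem[OF Q, of _ x]
  have "transitive t"
    unfolding transitive_def sub_def
  proof (intro allI impI)
    fix w z assume w: "w \<epsilon> t" "z \<epsilon> w"
    have "\<exists>b u. b \<epsilon> l \<and> rval x ?Q b u \<and> w \<epsilon> u"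
    proof (cases "w \<epsilon> x")
      case True
      then show ?thesis using rval_ex[OF Q] mem l(1,2) ord_mem by blast
    next
      case False
      then obtain b u where b: "b \<epsilon> l" "rval x ?Q b u" "?Q w u" using w(1) mem[OF l(1) t] by blast
      have "ord (S b)" using b(1) l(1) ord_mem ord_S by blast
      moreover obtain u' where "rval x ?Q (S b) u'" using rval_ex[OF Q] calculation by blast
      ultimately have "w \<epsilon> u'" using mem b(2,3) in_S by blast
      then show ?thesis using \<open>rval x ?Q (S b) u'\<close> l(3)[OF b(1)] by blast
    qed
    then show "z \<epsilon> t" using mem[OF l(1) t] w(2) by blast
  qed
  moreover have "sub x t" unfolding sub_def using mem[OF l(1) t] by blast
  ultimately show ?thesis by blast
qed

text \<open>Foundation speaks of sets only, so a minimal counterexample is sought inside a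
  transitive superset of \<open>x\<close>.\<close>

lemma mem_induct [consumes 1, case_names step]:
  assumes "dfn (\<lambda>e. P (e 0))" and step: "\<And>x. (\<And>y. y \<epsilon> x \<Longrightarrow> P y) \<Longrightarrow> P x"
  shows "P x"
proof -
  obtain t where t: "transitive t" "sub x t" using transitive_superset by blast
  obtain B where B: "\<And>z. z \<epsilon> B \<longleftrightarrow> z \<epsilon> t \<and> \<not> P z"
    using separation_ex[of "\<lambda>z. \<not> P z" t] dfn_not[OF assms(1)] by blast
  have "P y" if "y \<epsilon> t" for y
  proof (rule ccontr)
    assume "\<not> P y"
    then have "y \<epsilon> B" using that B by blast
    then obtain b where b: "b \<epsilon> B" "\<And>z. z \<epsilon> b \<Longrightarrow> \<not> z \<epsilon> B" using foundation_ex by blast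
    then have "b \<epsilon> t" "\<not> P b" using B by blast+
    moreover have "P z" if "z \<epsilon> b" for z
      using b(2)[OF that] B transitiveD[OF t(1) \<open>b \<epsilon> t\<close> that] by blast
    ultimately show False using step by blast
  qed
  then show ?thesis using t(2) step[of x] unfolding sub_def by blast
qed

subsection \<open>The cumulative hierarchy\<close>

lemma sub_dfn_set: "dfn (\<lambda>e. sub (e 0) (e (Suc 0)))" "\<exists>s. \<forall>z. z \<epsilon> s \<longleftrightarrow> sub z u"
  by (intro dfn_all_intros) (rule pow_ex)

definition inV :: "'a \<Rightarrow> 'a \<Rightarrow> bool" where
  "inV x b \<longleftrightarrow> (\<exists>v. rval emp sub b v \<and> x \<epsilon> v)"

lemma sat_hierarchy_fm: "sat UNIV (\<epsilon>) e (hierarchy_fm f d) \<longleftrightarrow> recf emp sub (e f) (e d)"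
proof -
  let ?H = "\<^bold>\<forall>(0 \<^bold>\<in> 1 \<^bold>\<longleftrightarrow> \<^bold>\<exists>(0 \<^bold>\<in> 3 \<^bold>\<and> \<^bold>\<exists>(app_fm (f + 5) 1 0 \<^bold>\<and> subset_fm 2 0)))"
  have "sat UNIV (\<epsilon>) (case_nat v (case_nat a e)) ?H \<longleftrightarrow>
      (\<forall>z. z \<epsilon> v \<longleftrightarrow> (\<exists>b. b \<epsilon> a \<and> (\<exists>u. app (e f) b u \<and> sub z u)))" for v a
    unfolding sat.simps(5) sat_connectives(3) sat_Iff
    by (simp add: sat_app_fm sat_subset_fm eval_nat_numeral)
  then have "sat UNIV (\<epsilon>) e (\<^bold>\<forall>(0 \<^bold>\<in> Suc d \<^bold>\<longrightarrow> \<^bold>\<forall>(app_fm (f + 2) 1 0 \<^bold>\<longrightarrow> ?H))) \<longleftrightarrow>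
      (\<forall>a. a \<epsilon> e d \<longrightarrow> (\<forall>v. app (e f) a v \<longrightarrow>
        (\<forall>z. z \<epsilon> v \<longleftrightarrow> (\<exists>b. b \<epsilon> a \<and> (\<exists>u. app (e f) b u \<and> sub z u)))))"
    unfolding sat.simps(5)[of _ _ _ "_ \<^bold>\<longrightarrow> _"] sat.simps(4)[of _ _ _ "0 \<^bold>\<in> Suc d"]
      sat.simps(4)[of _ _ _ "app_fm (f + 2) 1 0"]
    by (simp add: sat_app_fm eval_nat_numeral del: sat.simps(5))
  then show ?thesis
    unfolding hierarchy_fm_def recf_def sat_connectives(1) sat_function_fm by simp
qed

lemma sat_in_V_fm: "sat UNIV (\<epsilon>) e (in_V_fm x b) \<longleftrightarrow> inV (e x) (e b)"
  by (simp add: in_V_fm_def V_fm_def inV_def rval_def sat_succ_fm sat_hierarchy_fm sat_app_fm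
      eval_nat_numeral del: is_succ_iff)

lemma dfn_inV: "tm t \<Longrightarrow> tm u \<Longrightarrow> dfn (\<lambda>e. inV (t e) (u e))"
  by (rule dfn_subst2[of inV])
    (use dfn_sat[of "in_V_fm 0 (Suc 0)"] in \<open>simp_all only: sat_in_V_fm\<close>)

text \<open>This recursion, free of approximations, is the form in which the later lemmas use the
  hierarchy.\<close>

lemma inV_iff: "ord b \<Longrightarrow> inV x b \<longleftrightarrow> (\<exists>c. c \<epsilon> b \<and> (\<forall>y. y \<epsilon> x \<longrightarrow> inV y c))"
proof -
  assume b: "ord b"
  obtain v where v: "rval emp sub b v" using rval_ex[OF sub_dfn_set b] by blast
  have "inV x b \<longleftrightarrow> x \<epsilon> v"
    unfolding inV_def using v rval_unique[OF sub_dfn_set b] by blast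
  also have "\<dots> \<longleftrightarrow> (\<exists>c. c \<epsilon> b \<and> (\<exists>u. rval emp sub c u \<and> sub x u))"
    using rval_mem[OF sub_dfn_set b v] by simp
  also have "\<dots> \<longleftrightarrow> (\<exists>c. c \<epsilon> b \<and> (\<forall>y. y \<epsilon> x \<longrightarrow> inV y c))"
  proof -
    have "(\<exists>u. rval emp sub c u \<and> sub x u) \<longleftrightarrow> (\<forall>y. y \<epsilon> x \<longrightarrow> inV y c)" if "c \<epsilon> b" for c
    proof -
      have c: "ord c" using b that ord_mem by blast
      obtain u where u: "rval emp sub c u" using rval_ex[OF sub_dfn_set c] by blast
      then have "rval emp sub c u' \<longleftrightarrow> u' = u" for u'
        using rval_unique[OF sub_dfn_set c] by blast
      then show ?thesis unfolding inV_def sub_def by simp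
    qed
    then show ?thesis by blast
  qed
  finally show ?thesis .
qed

lemma inV_mono: "ord c \<Longrightarrow> le b c \<Longrightarrow> inV x b \<Longrightarrow> inV x c"
  using inV_iff ord_mem ord_trans unfolding le_def by metis

lemma inV_mem: "ord b \<Longrightarrow> inV x b \<Longrightarrow> y \<epsilon> x \<Longrightarrow> inV y b"
  using inV_iff[of b x] inV_mono[of b] unfolding le_def by blast

lemma ord_inV_mem: "ord b \<Longrightarrow> ord a \<Longrightarrow> inV a b \<Longrightarrow> a \<epsilon> b"
proof -
  assume "ord b"
  have "dfn (\<lambda>e. \<forall>a. ord a \<longrightarrow> inV a (e 0) \<longrightarrow> a \<epsilon> e 0)"
    by (intro dfn_all_intros dfn_inV)
  then have "\<forall>a. ord a \<longrightarrow> inV a b \<longrightarrow> a \<epsilon> b" using \<open>ord b\<close>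
  proof (induction rule: ord_induct)
    case (step b)
    have "a \<epsilon> b" if a: "ord a" "inV a b" for a
    proof -
      obtain c where c: "c \<epsilon> b" "\<And>y. y \<epsilon> a \<Longrightarrow> inV y c" using inV_iff[OF step.hyps] a(2) by blast
      have "sub a c" unfolding sub_def using step.IH[OF c(1)] c(2) a(1) ord_mem by blast
      then have "le a c" using sub_imp_le a(1) c(1) step.hyps ord_mem by blast
      then show ?thesis unfolding le_def using c(1) step.hyps ord_trans by blast
    qed
    then show ?case by blast
  qed
  then show "ord a \<Longrightarrow> inV a b \<Longrightarrow> a \<epsilon> b" by blast
qed

lemma mem_ord_inV: "ord b \<Longrightarrow> a \<epsilon> b \<Longrightarrow> inV a b"
proof -
  assume b: "ord b" "a \<epsilon> b"
  have "dfn (\<lambda>e. \<forall>b. ord b \<longrightarrow> e 0 \<epsilon> b \<longrightarrow> inV (e 0) b)"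
    by (intro dfn_all_intros dfn_inV)
  moreover have "ord a" using b ord_mem by blast
  ultimately have "\<forall>b. ord b \<longrightarrow> a \<epsilon> b \<longrightarrow> inV a b"
  proof (induction rule: ord_induct)
    case (step a)
    then show ?case using inV_iff by blast
  qed
  then show ?thesis using b by blast
qed

lemma inV_S_iff: "ord b \<Longrightarrow> inV x (S b) \<longleftrightarrow> (\<forall>y. y \<epsilon> x \<longrightarrow> inV y b)"
proof -
  assume b: "ord b"
  have "inV y b" if "c \<epsilon> S b" "inV y c" for y c
    using that inV_mono[OF b] unfolding le_def by auto
  then show ?thesis using inV_iff[OF ord_S[OF b]] by (meson in_S)
qed

text \<open>Induction on membership. Replacement collects the least levels containing the elements
  of \<open>x\<close>, minimality making the relation functional; the successor of their union works
  for \<open>x\<close>.\<close>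

lemma ex_inV: "\<exists>b. ord b \<and> inV x b"
proof -
  have "dfn (\<lambda>e. \<exists>b. ord b \<and> inV (e 0) b)" by (intro dfn_all_intros dfn_inV)
  then show ?thesis
  proof (induction x rule: mem_induct)
    case (step x)
    let ?R = "\<lambda>y b. ord b \<and> inV y b \<and> (\<forall>c. c \<epsilon> b \<longrightarrow> \<not> inV y c)"
    have "\<exists>A. \<forall>b. b \<epsilon> A \<longleftrightarrow> (\<exists>y. y \<epsilon> x \<and> ?R y b)"
    proof (rule replacement_ex)
      show "dfn (\<lambda>e. ?R (e 0) (e (Suc 0)))" by (intro dfn_all_intros dfn_inV)
      show "b = b'" if "?R y b" "?R y b'" for y b b' using that ord_linear by blast
    qed
    then obtain A where A: "\<And>b. b \<epsilon> A \<longleftrightarrow> (\<exists>y. y \<epsilon> x \<and> ?R y b)" by blast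
    have ord_A: "ord (bigcup A)" using A by (intro ord_bigcup) blast
    have "inV y (bigcup A)" if y: "y \<epsilon> x" for y
    proof -
      have "dfn (\<lambda>e. inV y (e 0))" by (intro dfn_inV dfn_intros)
      then obtain b where b: "?R y b" using step[OF y] ord_least[of "inV y"] by blast
      then have "b \<epsilon> A" using A y by blast
      then have "sub b (bigcup A)" unfolding sub_def by auto
      then show ?thesis using b inV_mono[OF ord_A] sub_imp_le ord_A by blast
    qed
    then show ?case using inV_S_iff[OF ord_A] ord_S[OF ord_A] by blast
  qed
qed

lemma inV_cofinal: "ord w \<Longrightarrow> \<exists>b. ord b \<and> le w b \<and> inV x b"
proof -
  assume w: "ord w"
  obtain b where b: "ord b" "inV x b" using ex_inV by blast
  show ?thesis
  proof (cases "le w b")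
    case True
    then show ?thesis using b by blast
  next
    case False
    then have "le b w" using ord_linear[OF w b(1)] unfolding le_def by blast
    then show ?thesis using w inV_mono[OF w _ b(2)] by (intro exI[of _ w]) auto
  qed
qed

end

section \<open>Prenex normal form\<close>

text \<open>The Levy classes contain only formulas literally in prenex form over a
  \<open>Delta0\<close> matrix, so passing from \<open>correct_scheme\<close> to all formulas
  requires a normal form.\<close>

inductive prenex :: "fm \<Rightarrow> bool" where
  Delta0: "Delta0 \<phi> \<Longrightarrow> prenex \<phi>"
| All: "prenex \<phi> \<Longrightarrow> prenex (\<^bold>\<forall>\<phi>)"
| Exi: "prenex \<phi> \<Longrightarrow> prenex (\<^bold>\<exists>\<phi>)"

lemma prenex_Levy: "prenex \<phi> \<Longrightarrow> \<exists>n. Levy_Sigma n \<phi>"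
proof (induction rule: prenex.induct)
  case (Delta0 \<phi>)
  then show ?case by (blast intro: Levy_Sigma_Levy_Pi.intros)
next
  case (All \<phi>)
  then show ?case by (blast intro: Levy_Sigma_Levy_Pi.intros)
next
  case (Exi \<phi>)
  then show ?case by (blast intro: Levy_Sigma_Levy_Pi.intros)
qed

lemma Delta0_rename: "Delta0 \<phi> \<Longrightarrow> Delta0 (rename r \<phi>)"
  by (induction arbitrary: r rule: Delta0.induct) (auto intro: Delta0.intros)

lemma prenex_rename: "prenex \<phi> \<Longrightarrow> prenex (rename r \<phi>)"
  by (induction arbitrary: r rule: prenex.induct) (auto intro: prenex.intros Delta0_rename)

text \<open>Only nonempty domains count, since the two laws of \<open>equivalent_pull\<close> that
  create an existential quantifier fail in the empty structure. The \<open>itself\<close> argument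
  names the carrier type of the structures.\<close>

definition equivalent :: "'a itself \<Rightarrow> fm \<Rightarrow> fm \<Rightarrow> bool" where
  "equivalent _ \<phi> \<psi> \<longleftrightarrow>
     (\<forall>(D :: 'a set) E e. D \<noteq> {} \<longrightarrow> sat D E e \<phi> = sat D E e \<psi>) \<and> fv \<psi> \<subseteq> fv \<phi>"

lemma equivalent_refl: "equivalent TYPE('a) \<phi> \<phi>"
  unfolding equivalent_def by simp

lemma equivalent_trans:
  "equivalent TYPE('a) \<phi> \<psi> \<Longrightarrow> equivalent TYPE('a) \<psi> \<chi> \<Longrightarrow> equivalent TYPE('a) \<phi> \<chi>"
  unfolding equivalent_def by auto

lemma equivalent_Imp:
  "equivalent TYPE('a) \<phi> \<phi>' \<Longrightarrow> equivalent TYPE('a) \<psi> \<psi>' \<Longrightarrow>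
    equivalent TYPE('a) (\<phi> \<^bold>\<longrightarrow> \<psi>) (\<phi>' \<^bold>\<longrightarrow> \<psi>')"
  unfolding equivalent_def by auto

lemma equivalent_All: "equivalent TYPE('a) \<phi> \<psi> \<Longrightarrow> equivalent TYPE('a) (\<^bold>\<forall>\<phi>) (\<^bold>\<forall>\<psi>)"
  unfolding equivalent_def by auto

lemma equivalent_Exi: "equivalent TYPE('a) \<phi> \<psi> \<Longrightarrow> equivalent TYPE('a) (\<^bold>\<exists>\<phi>) (\<^bold>\<exists>\<psi>)"
  unfolding equivalent_def by auto

lemma equivalent_pull:
  "equivalent TYPE('a) (\<phi> \<^bold>\<longrightarrow> \<^bold>\<forall>\<psi>) (\<^bold>\<forall>(rename Suc \<phi> \<^bold>\<longrightarrow> \<psi>))"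
  "equivalent TYPE('a) (\<phi> \<^bold>\<longrightarrow> \<^bold>\<exists>\<psi>) (\<^bold>\<exists>(rename Suc \<phi> \<^bold>\<longrightarrow> \<psi>))"
  "equivalent TYPE('a) (\<^bold>\<forall>\<phi> \<^bold>\<longrightarrow> \<psi>) (\<^bold>\<exists>(\<phi> \<^bold>\<longrightarrow> rename Suc \<psi>))"
  "equivalent TYPE('a) (\<^bold>\<exists>\<phi> \<^bold>\<longrightarrow> \<psi>) (\<^bold>\<forall>(\<phi> \<^bold>\<longrightarrow> rename Suc \<psi>))"
  unfolding equivalent_def by (auto simp: sat_rename fv_rename)

lemma prenex_Imp_Delta0:
  "prenex \<psi> \<Longrightarrow> Delta0 \<phi> \<Longrightarrow> \<exists>\<chi>. prenex \<chi> \<and> equivalent TYPE('a) (\<phi> \<^bold>\<longrightarrow> \<psi>) \<chi>"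
proof (induction arbitrary: \<phi> rule: prenex.induct)
  case (Delta0 \<psi>)
  then show ?case using equivalent_refl by (blast intro: prenex.intros Delta0.intros)
next
  case (All \<psi>)
  then obtain \<chi> where "prenex \<chi>" "equivalent TYPE('a) (rename Suc \<phi> \<^bold>\<longrightarrow> \<psi>) \<chi>"
    using Delta0_rename by blast
  then show ?case using equivalent_trans[OF equivalent_pull(1) equivalent_All] prenex.All by blast
next
  case (Exi \<psi>)
  then obtain \<chi> where "prenex \<chi>" "equivalent TYPE('a) (rename Suc \<phi> \<^bold>\<longrightarrow> \<psi>) \<chi>"
    using Delta0_rename by blast
  then show ?case using equivalent_trans[OF equivalent_pull(2) equivalent_Exi] prenex.Exi by blast
qed

lemma prenex_Imp:
  "prenex \<phi> \<Longrightarrow> prenex \<psi> \<Longrightarrow> \<exists>\<chi>. prenex \<chi> \<and> equivalent TYPE('a) (\<phi> \<^bold>\<longrightarrow> \<psi>) \<chi>"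
proof (induction arbitrary: \<psi> rule: prenex.induct)
  case (Delta0 \<phi>)
  then show ?case using prenex_Imp_Delta0 by blast
next
  case (All \<phi>)
  then obtain \<chi> where "prenex \<chi>" "equivalent TYPE('a) (\<phi> \<^bold>\<longrightarrow> rename Suc \<psi>) \<chi>"
    using prenex_rename by blast
  then show ?case using equivalent_trans[OF equivalent_pull(3) equivalent_Exi] prenex.Exi by blast
next
  case (Exi \<phi>)
  then obtain \<chi> where "prenex \<chi>" "equivalent TYPE('a) (\<phi> \<^bold>\<longrightarrow> rename Suc \<psi>) \<chi>"
    using prenex_rename by blast
  then show ?case using equivalent_trans[OF equivalent_pull(4) equivalent_All] prenex.All by blast
qed

lemma prenex_normal_form: "\<exists>\<chi>. prenex \<chi> \<and> equivalent TYPE('a) \<phi> \<chi>"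
proof (induction \<phi>)
  case (Imp \<phi> \<psi>)
  then obtain \<phi>' \<psi>' where *: "prenex \<phi>'" "equivalent TYPE('a) \<phi> \<phi>'"
    "prenex \<psi>'" "equivalent TYPE('a) \<psi> \<psi>'"
    by blast
  then obtain \<chi> where "prenex \<chi>" "equivalent TYPE('a) (\<phi>' \<^bold>\<longrightarrow> \<psi>') \<chi>" using prenex_Imp by blast
  then show ?case using equivalent_trans[OF equivalent_Imp] * by blast
next
  case (All \<phi>)
  then show ?case using equivalent_All prenex.All by blast
qed (blast intro: equivalent_refl prenex.Delta0 Delta0.intros)+

section \<open>Rank potentialism in a model of ZFC\<close>

text \<open>As existential quantifiers are negated universal ones, they turn into possibility
  followed by existence.\<close>

primrec potential :: "fm \<Rightarrow> mfm" where
  "potential (x \<^bold>\<in> y) = MMem x y"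
| "potential (x \<^bold>= y) = MEq x y"
| "potential \<^bold>\<bottom> = MFls"
| "potential (\<phi> \<^bold>\<longrightarrow> \<psi>) = MImp (potential \<phi>) (potential \<psi>)"
| "potential (\<^bold>\<forall>\<phi>) = MBox (MAll (potential \<phi>))"

lemma mfv_potential: "mfv (potential \<phi>) = fv \<phi>"
  by (induction \<phi>) auto

context zfc
begin

primrec mtrue :: "mfm \<Rightarrow> (nat \<Rightarrow> 'a) \<Rightarrow> 'a \<Rightarrow> bool" where
  "mtrue (MMem x y) e w = (e x \<epsilon> e y)"
| "mtrue (MEq x y) e w = (e x = e y)"
| "mtrue MFls e w = False"
| "mtrue (MImp \<phi> \<psi>) e w = (mtrue \<phi> e w \<longrightarrow> mtrue \<psi> e w)"
| "mtrue (MAll \<phi>) e w = (\<forall>x. inV x w \<longrightarrow> mtrue \<phi> (case_nat x e) w)"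
| "mtrue (MBox \<phi>) e w = (\<forall>u. ord u \<and> le w u \<longrightarrow> mtrue \<phi> e u)"

lemma sat_le_fm: "sat UNIV (\<epsilon>) e (le_fm x y) \<longleftrightarrow> le (e x) (e y)"
  by (auto simp: le_fm_def le_def)

lemma sat_true_at: "sat UNIV (\<epsilon>) e (true_at \<phi> f w) \<longleftrightarrow> mtrue \<phi> (\<lambda>i. e (f i)) (e w)"
proof (induction \<phi> arbitrary: e f w)
  case (MAll \<phi>)
  have "(\<lambda>i. case_nat x e (case_nat 0 (\<lambda>i. Suc (f i)) i)) = case_nat x (\<lambda>i. e (f i))" for x
    by (auto split: nat.split)
  then show ?case by (simp add: MAll sat_in_V_fm)
next
  case (MBox \<phi>)
  then show ?case by (simp add: sat_ord_fm sat_le_fm)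
qed auto

lemma mtrue_cong: "(\<And>i. i \<in> mfv \<phi> \<Longrightarrow> e i = e' i) \<Longrightarrow> mtrue \<phi> e w = mtrue \<phi> e' w"
proof (induction \<phi> arbitrary: e e' w)
  case (MImp \<phi> \<psi>)
  then show ?case by (metis UnCI mfv.simps(4) mtrue.simps(4))
next
  case (MAll \<phi>)
  have "mtrue \<phi> (case_nat x e) w = mtrue \<phi> (case_nat x e') w" for x
    using MAll.prems by (intro MAll.IH) (auto split: nat.split)
  then show ?case by simp
next
  case (MBox \<phi>)
  have "mtrue \<phi> e u = mtrue \<phi> e' u" for u using MBox.prems by (intro MBox.IH) auto
  then show ?case by simp
qed auto

text \<open>The outermost quantifier of \<open>params_in_V\<close> binds the parameter of highest
  index, so in the induction its value \<open>x\<close> comes after the first \<open>k\<close>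
  entries.\<close>

lemma shift_env:
  "(\<lambda>i. if i < k then e i else case_nat x s (i - k)) =
   (\<lambda>i. if i < Suc k then (if i < k then e i else x) else s (i - Suc k))"
proof
  fix i
  have "i - k = Suc (i - Suc k)" if "k < i" using that by simp
  then show "(if i < k then e i else case_nat x s (i - k)) =
      (if i < Suc k then (if i < k then e i else x) else s (i - Suc k))"
    by (cases i k rule: linorder_cases) auto
qed

lemma sat_params_in_V:
  "sat UNIV (\<epsilon>) s (params_in_V k d \<phi>) \<longleftrightarrow>
     (\<forall>e. (\<forall>i<k. inV (e i) (s d)) \<longrightarrow> sat UNIV (\<epsilon>) (\<lambda>i. if i < k then e i else s (i - k)) \<phi>)"
proof (induction k arbitrary: s d)
  case (Suc k)
  show ?case (is "?L \<longleftrightarrow> ?R")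
  proof
    assume L: ?L
    show ?R
    proof (intro allI impI)
      fix e assume e: "\<forall>i<Suc k. inV (e i) (s d)"
      let ?s = "case_nat (e k) s"
      have "sat UNIV (\<epsilon>) ?s (params_in_V k (Suc d) \<phi>)" using L e by (simp add: sat_in_V_fm)
      then have "sat UNIV (\<epsilon>) (\<lambda>i. if i < k then e i else ?s (i - k)) \<phi>"
        unfolding Suc.IH using e by simp
      moreover have "(\<lambda>i. if i < k then e i else ?s (i - k)) = (\<lambda>i. if i < Suc k then e i else s (i - Suc k))"
        unfolding shift_env by (auto simp: fun_eq_iff less_Suc_eq)
      ultimately show "sat UNIV (\<epsilon>) (\<lambda>i. if i < Suc k then e i else s (i - Suc k)) \<phi>" by simp
    qed
  next
    assume R: ?R
    have "sat UNIV (\<epsilon>) (case_nat x s) (params_in_V k (Suc d) \<phi>)" if x: "inV x (s d)" for x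
      unfolding Suc.IH
    proof (intro allI impI)
      fix e assume e: "\<forall>i<k. inV (e i) (case_nat x s (Suc d))"
      let ?e = "\<lambda>i. if i < k then e i else x"
      have "\<forall>i<Suc k. inV (?e i) (s d)" using e x by simp
      then have "sat UNIV (\<epsilon>) (\<lambda>i. if i < Suc k then ?e i else s (i - Suc k)) \<phi>"
        by (rule mp[OF spec[OF R, of ?e]])
      moreover have "(\<lambda>i. if i < Suc k then ?e i else s (i - Suc k))
          = (\<lambda>i. if i < k then e i else case_nat x s (i - k))"
        by (rule shift_env[symmetric])
      ultimately show "sat UNIV (\<epsilon>) (\<lambda>i. if i < k then e i else case_nat x s (i - k)) \<phi>" by simp
    qed
    then show ?L by (simp add: sat_in_V_fm)
  qed
qed simp

lemma sat_relativize: "sat UNIV (\<epsilon>) e (relativize \<phi> d) \<longleftrightarrow> sat {x. inV x (e d)} (\<epsilon>) e \<phi>"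
  by (induction \<phi> arbitrary: e d) (auto simp: sat_in_V_fm)

lemma sat_true_at_V:
  assumes "mfv \<psi> \<subseteq> {..<k}"
  shows "sat UNIV (\<epsilon>) s (true_at_V k \<psi>) \<longleftrightarrow> (\<forall>e. (\<forall>i<k. inV (e i) (s 0)) \<longrightarrow> mtrue \<psi> e (s 0))"
proof -
  have "mtrue \<psi> (\<lambda>i. if i < k then e i else s (i - k)) (s 0) \<longleftrightarrow> mtrue \<psi> e (s 0)" for e
    using assms by (intro mtrue_cong) auto
  then show ?thesis unfolding true_at_V_def sat_params_in_V sat_true_at by simp
qed

text \<open>Environments lie entirely in \<open>V_\<delta>\<close>. If \<open>V_\<delta>\<close>
  were empty there would be none, and the second clause would hold vacuously; the first clause rules
  this out.\<close>

definition elementary :: "'a \<Rightarrow> bool" where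
  "elementary \<delta> \<longleftrightarrow> (\<exists>x. inV x \<delta>) \<and>
     (\<forall>\<phi> e. (\<forall>i. inV (e i) \<delta>) \<longrightarrow> sat UNIV (\<epsilon>) e \<phi> = sat {x. inV x \<delta>} (\<epsilon>) e \<phi>)"

lemma elementaryD:
  "elementary \<delta> \<Longrightarrow> (\<And>i. inV (e i) \<delta>) \<Longrightarrow> sat UNIV (\<epsilon>) e \<phi> = sat {x. inV x \<delta>} (\<epsilon>) e \<phi>"
  unfolding elementary_def by blast

lemma sat_elementary_instance:
  assumes "fv \<phi> \<subseteq> {..<k}"
  shows "sat UNIV (\<epsilon>) s (params_in_V k 0 (\<phi> \<^bold>\<longleftrightarrow> relativize \<phi> k)) \<longleftrightarrow>
    (\<forall>e. (\<forall>i<k. inV (e i) (s 0)) \<longrightarrow> sat UNIV (\<epsilon>) e \<phi> = sat {x. inV x (s 0)} (\<epsilon>) e \<phi>)"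
proof -
  have "sat D (\<epsilon>) (\<lambda>i. if i < k then e i else s (i - k)) \<phi> = sat D (\<epsilon>) e \<phi>" for e D
    using assms by (intro sat_cong) auto
  then show ?thesis unfolding sat_params_in_V sat_Iff sat_relativize by simp
qed

lemma fv_bounded: "\<exists>k. fv \<phi> \<subseteq> {..<k}"
  using finite_fv[of \<phi>] by (metis finite_nat_iff_bounded)

lemma correct_imp_elementary:
  assumes "\<forall>\<psi>\<in>correct_scheme. sat UNIV (\<epsilon>) s \<psi>"
  shows "elementary (s 0)"
proof -
  have inst: "sat UNIV (\<epsilon>) e \<phi> = sat {x. inV x (s 0)} (\<epsilon>) e \<phi>"
    if "Levy_Sigma n \<phi>" "fv \<phi> \<subseteq> {..<k}" "\<forall>i<k. inV (e i) (s 0)" for n k \<phi> e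
  proof -
    have "params_in_V k 0 (\<phi> \<^bold>\<longleftrightarrow> relativize \<phi> k) \<in> correct_scheme"
      unfolding correct_scheme_def elementary_scheme_def using that(1,2) by blast
    then show ?thesis using assms sat_elementary_instance[OF that(2)] that(3) by blast
  qed
  \<comment> \<open>The existence of some set is a Sigma-1 sentence true in the model, so the scheme
    with \<open>k = 0\<close> makes \<open>V_\<delta>\<close> nonempty.\<close>
  have "Levy_Sigma (Suc 0) (\<^bold>\<exists>(0 \<^bold>= 0))"
    by (intro Levy_Sigma_Levy_Pi.intros Delta0.intros)
  from inst[OF this, of 0 s] have ne: "\<exists>x. inV x (s 0)" by simp
  have "sat UNIV (\<epsilon>) e \<phi> = sat {x. inV x (s 0)} (\<epsilon>) e \<phi>" if e: "\<forall>i. inV (e i) (s 0)" for e \<phi>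
  proof -
    obtain \<chi> where \<chi>: "prenex \<chi>" "equivalent TYPE('a) \<phi> \<chi>" using prenex_normal_form by blast
    obtain n where "Levy_Sigma n \<chi>" using prenex_Levy \<chi>(1) by blast
    moreover obtain k where "fv \<chi> \<subseteq> {..<k}" using fv_bounded by blast
    ultimately have "sat UNIV (\<epsilon>) e \<chi> = sat {x. inV x (s 0)} (\<epsilon>) e \<chi>" using inst e by blast
    then show ?thesis using \<chi>(2) ne unfolding equivalent_def by auto
  qed
  then show ?thesis using ne unfolding elementary_def by blast
qed

lemma elementary_imp_correct:
  assumes "elementary (s 0)" "\<psi> \<in> correct_scheme"
  shows "sat UNIV (\<epsilon>) s \<psi>"
proof -
  obtain n k \<phi> where \<psi>: "\<psi> = params_in_V k 0 (\<phi> \<^bold>\<longleftrightarrow> relativize \<phi> k)" and k: "fv \<phi> \<subseteq> {..<k}"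
    using assms(2) unfolding correct_scheme_def elementary_scheme_def by blast
  obtain c where c: "inV c (s 0)" using assms(1) unfolding elementary_def by blast
  have "sat UNIV (\<epsilon>) e \<phi> = sat {x. inV x (s 0)} (\<epsilon>) e \<phi>" if e: "\<forall>i<k. inV (e i) (s 0)" for e
  proof -
    \<comment> \<open>\<open>elementary\<close> speaks of total environments in
      \<open>V_\<delta>\<close>; entries from \<open>k\<close> on, which do not occur in
      \<open>\<phi>\<close>, are filled with \<open>c\<close>.\<close>
    let ?e = "\<lambda>i. if i < k then e i else c"
    have "sat D (\<epsilon>) ?e \<phi> = sat D (\<epsilon>) e \<phi>" for D using k by (intro sat_cong) auto
    moreover have "sat UNIV (\<epsilon>) ?e \<phi> = sat {x. inV x (s 0)} (\<epsilon>) ?e \<phi>"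
      using e c by (intro elementaryD[OF assms(1)]) auto
    ultimately show ?thesis by blast
  qed
  then show ?thesis unfolding \<psi> sat_elementary_instance[OF k] by blast
qed

text \<open>The statement that \<open>\<phi>\<close> holds at some \<open>V\<^sub>\<gamma>\<close> with \<open>\<gamma> \<ge> \<alpha>\<close> is true for all \<open>\<alpha> < \<delta>\<close>, hence, by
  elementarity, for all ordinals \<open>\<alpha>\<close>.\<close>

lemma elementary_unbounded:
  assumes \<delta>: "ord \<delta>" "elementary \<delta>" and e: "\<And>i. inV (e i) \<delta>"
    and u: "ord u" "le \<delta> u" "mtrue \<phi> e u" and a: "ord a"
  shows "\<exists>v. ord v \<and> le a v \<and> mtrue \<phi> e v"
proof -
  let ?V = "{x. inV x \<delta>}"
  \<comment> \<open>Variable 0 is the world sought, variable 1 the lower bound \<open>a\<close>, and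
    the parameters follow from 2 on.\<close>
  let ?\<chi> = "\<^bold>\<exists>(ord_fm 0 \<^bold>\<and> le_fm 1 0 \<^bold>\<and> true_at \<phi> (\<lambda>i. i + 2) 0)"
  have \<chi>: "sat UNIV (\<epsilon>) (case_nat a e) ?\<chi> \<longleftrightarrow> (\<exists>v. ord v \<and> le a v \<and> mtrue \<phi> e v)" for a
    unfolding sat_connectives(3) sat_connectives(1) sat_ord_fm sat_le_fm sat_true_at by simp
  have elem: "sat UNIV (\<epsilon>) e \<psi> = sat ?V (\<epsilon>) e \<psi>" if "\<And>i. inV (e i) \<delta>" for e \<psi>
    using \<delta>(2) that unfolding elementary_def by blast
  have "sat ?V (\<epsilon>) e (\<^bold>\<forall>(ord_fm 0 \<^bold>\<longrightarrow> ?\<chi>))"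
    unfolding sat.simps(5) sat.simps(4)[of _ _ _ "ord_fm 0"]
  proof (intro ballI impI)
    fix b assume "b \<in> ?V" and ord: "sat ?V (\<epsilon>) (case_nat b e) (ord_fm 0)"
    then have b: "inV (case_nat b e i) \<delta>" for i using e by (simp split: nat.split)
    have "sat UNIV (\<epsilon>) (case_nat b e) (ord_fm 0)" using ord elem[of "case_nat b e"] b by blast
    then have "ord b" unfolding sat_ord_fm by simp
    then have "b \<epsilon> \<delta>" using ord_inV_mem \<delta>(1) \<open>b \<in> ?V\<close> by blast
    then have "le b u" using u(1,2) le_trans unfolding le_def by blast
    then have "sat UNIV (\<epsilon>) (case_nat b e) ?\<chi>" unfolding \<chi> using u(1,3) by blast
    then show "sat ?V (\<epsilon>) (case_nat b e) ?\<chi>" using elem[of "case_nat b e"] b by blast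
  qed
  then have "sat UNIV (\<epsilon>) e (\<^bold>\<forall>(ord_fm 0 \<^bold>\<longrightarrow> ?\<chi>))" using elem e by blast
  then have "\<forall>a. ord a \<longrightarrow> sat UNIV (\<epsilon>) (case_nat a e) ?\<chi>"
    unfolding sat.simps(5)[of _ _ _ "_ \<^bold>\<longrightarrow> _"] sat.simps(4)[of _ _ _ "ord_fm 0"] sat_ord_fm by simp
  then show ?thesis unfolding \<chi> using a by blast
qed

text \<open>The claim covers all worlds from \<open>V_\<delta>\<close> on, so that
  \<open>Nec\<close> passes through. For \<open>Five\<close>, what is true at one of these worlds
  recurs unboundedly by \<open>elementary_unbounded\<close>, hence stays possible.\<close>

lemma elementary_S5:
  assumes \<delta>: "ord \<delta>" "elementary \<delta>" and e: "\<And>i. inV (e i) \<delta>"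
    and "p \<in> S5" "ord u" "le \<delta> u"
  shows "mtrue (psubst \<sigma> p) e u"
  using assms(4-6)
proof (induction arbitrary: u rule: S5.induct)
  case (Five p)
  have "\<exists>v'. ord v' \<and> le w v' \<and> mtrue (psubst \<sigma> p) e v'"
    if "ord v" "le u v" "mtrue (psubst \<sigma> p) e v" "ord w" for v w
    using elementary_unbounded[OF \<delta> e that(1) le_trans[OF that(1) Five.prems(2) that(2)] that(3,4)] .
  then show ?case by (simp; blast)
next
  case (Nec p)
  have "mtrue (psubst \<sigma> p) e v" if "ord v" "le u v" for v
    using Nec.IH[OF that(1) le_trans[OF that(1) Nec.prems(2) that(2)]] .
  then show ?case by simp
next
  case (T p)
  then show ?case by (metis le_refl mtrue.simps(4,6) psubst.simps(3,4))
qed simp_all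

end

subsection \<open>A dial\<close>

abbreviation MTru :: mfm where
  "MTru \<equiv> MImp MFls MFls"

text \<open>A chain of \<open>k\<close> membership steps leads upward from variable 0 inside the
  current world.\<close>

primrec above_fm :: "nat \<Rightarrow> mfm" where
  "above_fm 0 = MTru"
| "above_fm (Suc k) = MImp (MAll (MImp (MMem (Suc 0) 0) (MImp (above_fm k) MFls))) MFls"

text \<open>Some element has a membership chain of length \<open>m\<close> above it but none of
  length \<open>m + 1\<close>. At a limit level this never happens; \<open>j\<close> steps above a
  limit it happens exactly for \<open>m < j\<close>.\<close>

definition gap_fm :: "nat \<Rightarrow> mfm" where
  "gap_fm m = MImp (MAll (MImp (above_fm m) (above_fm (Suc m)))) MFls"

text \<open>If \<open>j \<le> n\<close> is the largest number with \<open>j = 0\<close> or \<open>gap_fm (j - 1)\<close> at the current world,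
  then \<open>dial_fm b n\<close> says \<open>b j\<close>.\<close>

primrec dial_fm :: "(nat \<Rightarrow> bool) \<Rightarrow> nat \<Rightarrow> mfm" where
  "dial_fm b 0 = (if b 0 then MTru else MFls)"
| "dial_fm b (Suc m) =
     MImp (MImp (MImp (gap_fm m) (if b (Suc m) then MTru else MFls))
       (MImp (MImp (MImp (gap_fm m) MFls) (dial_fm b m)) MFls)) MFls"

lemma mfv_above_fm: "mfv (above_fm k) \<subseteq> {0}"
  by (induction k) auto

lemma mfv_gap_fm: "mfv (gap_fm m) = {}"
  using mfv_above_fm[of m] mfv_above_fm[of "Suc m"] unfolding gap_fm_def by auto

lemma mfv_dial_fm: "mfv (dial_fm b m) = {}"
  by (induction m) (auto simp: mfv_gap_fm)

lemma mfv_psubst: "(\<And>i. mfv (\<sigma> i) = {}) \<Longrightarrow> mfv (psubst \<sigma> p) = {}"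
  by (induction p) auto

context zfc
begin

text \<open>The number displayed by \<open>dial_fm\<close>. The constant environment is a
  placeholder, as \<open>gap_fm\<close> is closed.\<close>

primrec dial :: "nat \<Rightarrow> 'a \<Rightarrow> nat" where
  "dial 0 w = 0"
| "dial (Suc m) w = (if mtrue (gap_fm m) (\<lambda>_. emp) w then Suc m else dial m w)"

lemma dial_le: "dial m w \<le> m"
  by (induction m) auto

lemma mtrue_dial_fm: "mtrue (dial_fm b m) e w \<longleftrightarrow> b (dial m w)"
proof (induction m)
  case (Suc m)
  have "mtrue (gap_fm m) e w = mtrue (gap_fm m) (\<lambda>_. emp) w"
    by (rule mtrue_cong) (simp add: mfv_gap_fm)
  then show ?case using Suc by auto
qed simp

lemma ord_S_pow: "ord a \<Longrightarrow> ord ((S ^^ j) a)"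
  by (induction j) (auto simp: ord_S)

lemma S_pow_mono: "ord a \<Longrightarrow> i \<le> j \<Longrightarrow> le ((S ^^ i) a) ((S ^^ j) a)"
proof (induction j)
  case (Suc j)
  then show ?case
    using le_trans[of "(S ^^ Suc j) a" "(S ^^ i) a" "(S ^^ j) a"] ord_S_pow[of a "Suc j"]
    by (cases "i = Suc j") (auto simp: le_def)
qed simp

text \<open>For a limit \<open>\<delta>\<close>, the elements of \<open>V\<^bsub>\<delta>+j\<^esub>\<close> that start an \<open>\<in>\<close>-chain of length \<open>k\<close> inside it
  form \<open>V\<^bsub>\<delta>+(j-k)\<^esub>\<close> (truncated subtraction), because \<open>\<Union>V\<^bsub>\<beta>+1\<^esub> = V\<^bsub>\<beta>\<^esub>\<close> and \<open>\<Union>V\<^bsub>\<delta>\<^esub> = V\<^bsub>\<delta>\<^esub>\<close>.\<close>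

lemma mtrue_above_fm:
  assumes \<delta>: "ord \<delta>" and lim: "\<And>x. inV x \<delta> \<Longrightarrow> \<exists>y. x \<epsilon> y \<and> inV y \<delta>"
  shows "inV x ((S ^^ j) \<delta>) \<Longrightarrow>
    mtrue (above_fm k) (case_nat x e) ((S ^^ j) \<delta>) \<longleftrightarrow> inV x ((S ^^ (j - k)) \<delta>)"
proof (induction k arbitrary: x e)
  case (Suc k)
  have mono: "inV y ((S ^^ j) \<delta>)" if "inV y ((S ^^ (j - k)) \<delta>)" for y
    using that inV_mono[OF ord_S_pow[OF \<delta>]] S_pow_mono[OF \<delta>, of "j - k" j] by simp
  have "mtrue (above_fm (Suc k)) (case_nat x e) ((S ^^ j) \<delta>) \<longleftrightarrow>
      (\<exists>y. x \<epsilon> y \<and> inV y ((S ^^ (j - k)) \<delta>))"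
    using Suc.IH mono by auto
  also have "\<dots> \<longleftrightarrow> inV x ((S ^^ (j - Suc k)) \<delta>)"
  proof (cases "j - k")
    case 0
    then show ?thesis using lim inV_mem[OF \<delta>] by auto
  next
    case (Suc i)
    then have i: "j - Suc k = i" by simp
    \<comment> \<open>From right to left the singleton of \<open>x\<close> is the witness.\<close>
    have "(\<exists>y. x \<epsilon> y \<and> (\<forall>z. z \<epsilon> y \<longrightarrow> inV z ((S ^^ i) \<delta>))) \<longleftrightarrow> inV x ((S ^^ i) \<delta>)"
      using in_up[of _ x x] by metis
    then show ?thesis
      unfolding i Suc using inV_S_iff[OF ord_S_pow[OF \<delta>, of i]] by simp
  qed
  finally show ?case .
qed simp

lemma mtrue_gap_fm:
  assumes \<delta>: "ord \<delta>" and lim: "\<And>x. inV x \<delta> \<Longrightarrow> \<exists>y. x \<epsilon> y \<and> inV y \<delta>"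
  shows "mtrue (gap_fm m) e ((S ^^ j) \<delta>) \<longleftrightarrow> m < j"
proof -
  have "mtrue (gap_fm m) e ((S ^^ j) \<delta>) \<longleftrightarrow> (\<exists>x. inV x ((S ^^ j) \<delta>) \<and>
      inV x ((S ^^ (j - m)) \<delta>) \<and> \<not> inV x ((S ^^ (j - Suc m)) \<delta>))"
    unfolding gap_fm_def using mtrue_above_fm[OF assms]
    by (simp del: above_fm.simps)
  also have "\<dots> \<longleftrightarrow> m < j"
  proof (cases "m < j")
    case True
    \<comment> \<open>The ordinal indexing a level separates it from the next: it belongs to the
      next level but not to its own.\<close>
    let ?b = "(S ^^ (j - Suc m)) \<delta>"
    have b: "ord ?b" by (rule ord_S_pow[OF \<delta>])
    have jm: "j - m = Suc (j - Suc m)" using True by simp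
    have "inV ?b (S ?b)" using mem_ord_inV[OF ord_S[OF b]] by simp
    then have 1: "inV ?b ((S ^^ (j - m)) \<delta>)" unfolding jm by simp
    have "inV ?b ((S ^^ j) \<delta>)"
      using inV_mono[OF ord_S_pow[OF \<delta>] S_pow_mono[OF \<delta>, of "j - m" j] 1] by simp
    moreover have "\<not> inV ?b ?b" using ord_inV_mem[OF b b] by auto
    ultimately show ?thesis using True 1 by blast
  qed simp
  finally show ?thesis .
qed

lemma dial_S_pow:
  assumes "ord \<delta>" "\<And>x. inV x \<delta> \<Longrightarrow> \<exists>y. x \<epsilon> y \<and> inV y \<delta>"
  shows "dial m ((S ^^ j) \<delta>) = min m j"
  by (induction m) (auto simp: mtrue_gap_fm[OF assms] min_def)

text \<open>Some set contains \<open>x\<close> in the full model; elementarity finds one in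
  \<open>V_\<delta>\<close>, which thus behaves like a limit level.\<close>

lemma elementary_limit:
  assumes "elementary \<delta>" "inV x \<delta>"
  shows "\<exists>y. x \<epsilon> y \<and> inV y \<delta>"
proof -
  have "sat UNIV (\<epsilon>) (\<lambda>_. x) (\<^bold>\<exists>(1 \<^bold>\<in> 0)) = sat {x. inV x \<delta>} (\<epsilon>) (\<lambda>_. x) (\<^bold>\<exists>(1 \<^bold>\<in> 0))"
    using assms by (rule elementaryD)
  moreover have "\<exists>y. x \<epsilon> y" using in_up by blast
  ultimately show ?thesis by auto
qed

text \<open>Dial value \<open>j\<close> stands for the frame world \<open>g j\<close>, so atom
  \<open>i\<close> is translated as: the dial shows some \<open>j\<close> with
  \<open>i \<in> g j\<close>. All values recur above any world, so the potentialist box sees exactly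
  the worlds in \<open>W\<close>.\<close>

lemma elementary_refutes:
  assumes \<delta>: "ord \<delta>" "elementary \<delta>" and g: "g ` {..n} = W"
  shows "mtrue (psubst (\<lambda>i. dial_fm (\<lambda>j. i \<in> g j) n) p) e \<delta> \<longleftrightarrow> holds W (g 0) p"
proof -
  obtain c where c: "inV c \<delta>" using \<delta>(2) unfolding elementary_def by blast
  have dial_S_pow: "dial m ((S ^^ j) \<delta>) = min m j" for m j
    using dial_S_pow[OF \<delta>(1)] elementary_limit[OF \<delta>(2)] by blast
  have cofinal: "\<exists>v. ord v \<and> le u v \<and> dial n v = j" if "j \<le> n" "ord u" for j u
  proof -
    let ?u = "(S ^^ j) \<delta>"
    have "ord ?u" "le \<delta> ?u" using ord_S_pow[OF \<delta>(1)] S_pow_mono[OF \<delta>(1), of 0 j] by auto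
    moreover have "mtrue (dial_fm (\<lambda>i. i = j) n) (\<lambda>_. c) ?u"
      unfolding mtrue_dial_fm dial_S_pow using that(1) by simp
    ultimately show ?thesis
      using elementary_unbounded[OF \<delta>, of "\<lambda>_. c" ?u "dial_fm (\<lambda>i. i = j) n" u] c that(2)
      unfolding mtrue_dial_fm by blast
  qed
  have "mtrue (psubst (\<lambda>i. dial_fm (\<lambda>j. i \<in> g j) n) p) e u \<longleftrightarrow> holds W (g (dial n u)) p"
    if "ord u" for u
    using that
  proof (induction p arbitrary: u)
    case (PBox p)
    have "(\<forall>v. ord v \<and> le u v \<longrightarrow> holds W (g (dial n v)) p) \<longleftrightarrow> (\<forall>w\<in>W. holds W w p)"
    proof
      assume L: "\<forall>v. ord v \<and> le u v \<longrightarrow> holds W (g (dial n v)) p"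
      show "\<forall>w\<in>W. holds W w p"
      proof
        fix w assume "w \<in> W"
        then obtain j where "j \<le> n" "w = g j" using g by auto
        then show "holds W w p" using L cofinal[of j u] PBox.prems by blast
      qed
    next
      assume "\<forall>w\<in>W. holds W w p"
      moreover have "g (dial n v) \<in> W" for v using g dial_le[of n v] by auto
      ultimately show "\<forall>v. ord v \<and> le u v \<longrightarrow> holds W (g (dial n v)) p" by blast
    qed
    then show ?case using PBox.IH by auto
  qed (auto simp: mtrue_dial_fm)
  then show ?thesis using \<delta>(1) dial_S_pow[of n 0] by simp
qed

subsection \<open>Tarski--Vaught from S5\<close>

text \<open>The levels above any world exhaust the universe, so box followed by a universal
  quantifier ranges over all sets, whatever the world.\<close>

lemma mtrue_potential: "ord w \<Longrightarrow> mtrue (potential \<phi>) e w \<longleftrightarrow> sat UNIV (\<epsilon>) e \<phi>"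
proof (induction \<phi> arbitrary: e w)
  case (All \<phi>)
  have "mtrue (potential (\<^bold>\<forall>\<phi>)) e w \<longleftrightarrow>
      (\<forall>u. ord u \<and> le w u \<longrightarrow> (\<forall>x. inV x u \<longrightarrow> sat UNIV (\<epsilon>) (case_nat x e) \<phi>))"
    using All.IH by auto
  also have "\<dots> \<longleftrightarrow> (\<forall>x. sat UNIV (\<epsilon>) (case_nat x e) \<phi>)"
    using inV_cofinal[OF All.prems] by blast
  finally show ?case by simp
qed auto

lemma S5_imp_elementary:
  assumes S5: "\<forall>\<psi>\<in>S5_scheme. sat UNIV (\<epsilon>) s \<psi>" and \<delta>: "ord (s 0)"
  shows "elementary (s 0)"
proof -
  let ?\<delta> = "s 0"
  have witness: "\<exists>y. inV y ?\<delta> \<and> \<not> sat UNIV (\<epsilon>) (case_nat y e) \<phi>"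
    if k: "fv (\<^bold>\<forall>\<phi>) \<subseteq> {..<k}" and e: "\<forall>i<k. inV (e i) ?\<delta>"
      and x: "\<not> sat UNIV (\<epsilon>) (case_nat x e) \<phi>" for k e x \<phi>
  proof -
    \<comment> \<open>\<open>\<psi>\<close> says that the current world contains a counterexample to
      \<open>\<phi>\<close>, as evaluated in the whole universe.\<close>
    define \<psi> where "\<psi> = MImp (MAll (potential \<phi>)) MFls"
    have \<psi>: "mtrue \<psi> e u \<longleftrightarrow> (\<exists>y. inV y u \<and> \<not> sat UNIV (\<epsilon>) (case_nat y e) \<phi>)" if "ord u" for u
      unfolding \<psi>_def using mtrue_potential that by simp
    let ?p = "PImp (PDia (PBox (PAtom 0))) (PAtom 0)"
    have fv: "mfv (psubst (\<lambda>_. \<psi>) ?p) \<subseteq> {..<k}" using k by (simp add: \<psi>_def mfv_potential)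
    then have "true_at_V k (psubst (\<lambda>_. \<psi>) ?p) \<in> S5_scheme"
      unfolding S5_scheme_def validity_scheme_def using S5_dia_box by blast
    then have "sat UNIV (\<epsilon>) s (true_at_V k (psubst (\<lambda>_. \<psi>) ?p))" using S5 by blast
    then have "mtrue (psubst (\<lambda>_. \<psi>) ?p) e ?\<delta>" unfolding sat_true_at_V[OF fv] using e by blast
    moreover obtain u where u: "ord u" "le ?\<delta> u" "inV x u" using inV_cofinal[OF \<delta>] by blast
    \<comment> \<open>Once \<open>x\<close> has appeared it stays in all later worlds, so
      \<open>\<psi>\<close> is possibly necessary at \<open>V_\<delta>\<close>.\<close>
    have "mtrue \<psi> e v" if "ord v" "le u v" for v
      unfolding \<psi>[OF that(1)] using x inV_mono[OF that u(3)] by blast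
    ultimately have "mtrue \<psi> e ?\<delta>" using u by auto
    then show ?thesis using \<psi>[OF \<delta>] by blast
  qed
  \<comment> \<open>For the false formula every \<open>x\<close> is a counterexample, so the witness
    property without parameters puts an element into \<open>V_\<delta>\<close>.\<close>
  have ne: "\<exists>y. inV y ?\<delta>" using witness[of "\<^bold>\<bottom>" 0 s] by simp
  have "sat UNIV (\<epsilon>) e \<phi> = sat {x. inV x ?\<delta>} (\<epsilon>) e \<phi>" if "\<forall>i. inV (e i) ?\<delta>" for e \<phi>
    using that
  proof (induction \<phi> arbitrary: e)
    case (All \<phi>)
    obtain k where "fv (\<^bold>\<forall>\<phi>) \<subseteq> {..<k}" using fv_bounded by blast
    then have "(\<forall>x. sat UNIV (\<epsilon>) (case_nat x e) \<phi>) \<longleftrightarrow>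
        (\<forall>x. inV x ?\<delta> \<longrightarrow> sat UNIV (\<epsilon>) (case_nat x e) \<phi>)"
      using witness All.prems by blast
    moreover have "sat UNIV (\<epsilon>) (case_nat x e) \<phi> = sat {x. inV x ?\<delta>} (\<epsilon>) (case_nat x e) \<phi>"
      if "inV x ?\<delta>" for x
      using that All.prems by (intro All.IH) (simp split: nat.split)
    ultimately show ?case by simp
  qed auto
  then show ?thesis using ne unfolding elementary_def by blast
qed

end

section \<open>From models back to derivations\<close>

lemma fv_ZFC: "\<phi> \<in> ZFC \<Longrightarrow> fv \<phi> = {}"
  by (auto simp: ZFC_def extensionality_def foundation_def pairing_def union_ax_def powerset_def
      infinity_def choice_def subset_fm_def succ_fm_def eval_nat_numeral)

text \<open>The axioms are sentences, so truth under the single environment \<open>s\<close> gives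
  truth under every \<open>e\<close>, as \<open>zfc\<close> demands.\<close>

lemma zfc_modelI:
  assumes "\<forall>\<phi>\<in>ZFC_ord \<union> \<Gamma>. sat UNIV E s \<phi>"
  shows "zfc E" "zfc.ord E (s 0)"
proof -
  show "zfc E"
  proof
    fix \<phi> e assume \<phi>: "\<phi> \<in> ZFC"
    then have "sat UNIV E s \<phi>" using assms unfolding ZFC_ord_def by blast
    then show "sat UNIV E e \<phi>" using sat_cong[of \<phi> s e] fv_ZFC[OF \<phi>] by auto
  qed
  then show "zfc.ord E (s 0)"
    using assms zfc.sat_ord_fm unfolding ZFC_ord_def by blast
qed

theorem theorem14:
  shows "(\<forall>\<psi> \<in> S5_scheme. ZFC_ord \<union> correct_scheme \<turnstile> \<psi>) \<and>
         (\<forall>p. p \<notin> S5 \<longrightarrow> (\<exists>\<psi> \<in> validity_scheme p. ZFC_ord \<union> correct_scheme \<turnstile> \<^bold>\<not>\<psi>)) \<and>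
         (\<forall>\<psi> \<in> correct_scheme. ZFC_ord \<union> S5_scheme \<turnstile> \<psi>)"
proof (intro conjI ballI allI impI)
  fix \<psi> assume "\<psi> \<in> S5_scheme"
  then obtain p k \<sigma> where p: "p \<in> S5" "mfv (psubst \<sigma> p) \<subseteq> {..<k}"
    and \<psi>: "\<psi> = true_at_V k (psubst \<sigma> p)"
    unfolding S5_scheme_def validity_scheme_def by blast
  show "ZFC_ord \<union> correct_scheme \<turnstile> \<psi>"
  proof (rule ZFC_completeness)
    show "ZFC \<subseteq> ZFC_ord \<union> correct_scheme" unfolding ZFC_ord_def by blast
  next
    fix E :: "nat \<Rightarrow> nat \<Rightarrow> bool" and s
    assume M: "\<forall>\<psi>\<in>ZFC_ord \<union> correct_scheme. sat UNIV E s \<psi>"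
    interpret zfc E using zfc_modelI(1)[OF M] .
    have \<delta>: "ord (s 0)" "elementary (s 0)"
      using zfc_modelI(2)[OF M] correct_imp_elementary M by blast+
    obtain c where c: "inV c (s 0)" using \<delta>(2) unfolding elementary_def by blast
    have "mtrue (psubst \<sigma> p) e (s 0)" if "\<forall>i<k. inV (e i) (s 0)" for e
    proof -
      have "mtrue (psubst \<sigma> p) (\<lambda>i. if i < k then e i else c) (s 0)"
        using that c p(1) by (intro elementary_S5[OF \<delta>]) (auto simp: \<delta>(1))
      moreover have "mtrue (psubst \<sigma> p) (\<lambda>i. if i < k then e i else c) (s 0)
          = mtrue (psubst \<sigma> p) e (s 0)"
        using p(2) by (intro mtrue_cong) auto
      ultimately show ?thesis by blast
    qed
    then show "sat UNIV E s \<psi>" unfolding \<psi> sat_true_at_V[OF p(2)] by blast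
  qed
next
  fix p assume "p \<notin> S5"
  then obtain W v where W: "finite W" "v \<in> W" "\<not> holds W v p" by (rule S5_finite_model)
  obtain vs where vs: "set vs = W" using W(1) finite_list by blast
  \<comment> \<open>\<open>v\<close> heads the list because the dial shows 0 at
    \<open>V_\<delta>\<close>, where the instance has to fail. With \<open>v\<close> in front of the
    \<open>n\<close> entries of \<open>vs\<close>, the indices run from 0 to
    \<open>n\<close>.\<close>
  define g where "g = (\<lambda>j. (v # vs) ! j)"
  define n where "n = length vs"
  have g: "g ` {..n} = W" "g 0 = v"
  proof -
    have "g ` {..n} = set (v # vs)"
      unfolding g_def n_def by (auto simp: set_conv_nth image_def less_Suc_eq_le)
    then show "g ` {..n} = W" using vs W(2) by auto
  qed (simp add: g_def)
  define \<psi> where "\<psi> = psubst (\<lambda>i. dial_fm (\<lambda>j. i \<in> g j) n) p"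
  \<comment> \<open>The dial formulas are closed, so the refuting instance takes no parameters and
    \<open>true_at_V 0\<close> is the bare assertion at \<open>V_\<delta>\<close>.\<close>
  have fv: "mfv \<psi> \<subseteq> {..<0}" unfolding \<psi>_def by (simp add: mfv_psubst mfv_dial_fm)
  show "\<exists>\<psi> \<in> validity_scheme p. ZFC_ord \<union> correct_scheme \<turnstile> \<^bold>\<not>\<psi>"
  proof
    show "true_at_V 0 \<psi> \<in> validity_scheme p"
      using fv unfolding validity_scheme_def \<psi>_def by blast
    show "ZFC_ord \<union> correct_scheme \<turnstile> \<^bold>\<not>(true_at_V 0 \<psi>)"
    proof (rule ZFC_completeness)
      show "ZFC \<subseteq> ZFC_ord \<union> correct_scheme" unfolding ZFC_ord_def by blast
    next
      fix E :: "nat \<Rightarrow> nat \<Rightarrow> bool" and s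
      assume M: "\<forall>\<psi>\<in>ZFC_ord \<union> correct_scheme. sat UNIV E s \<psi>"
      interpret zfc E using zfc_modelI(1)[OF M] .
      have \<delta>: "ord (s 0)" "elementary (s 0)"
        using zfc_modelI(2)[OF M] correct_imp_elementary M by blast+
      have "\<not> mtrue \<psi> e (s 0)" for e
        unfolding \<psi>_def using elementary_refutes[OF \<delta> g(1)] W(3) g(2) by simp
      then have "\<not> sat UNIV E s (true_at_V 0 \<psi>)" unfolding sat_true_at_V[OF fv] by simp
      then show "sat UNIV E s (\<^bold>\<not>(true_at_V 0 \<psi>))" by simp
    qed
  qed
next
  fix \<psi> assume \<psi>: "\<psi> \<in> correct_scheme"
  show "ZFC_ord \<union> S5_scheme \<turnstile> \<psi>"
  proof (rule ZFC_completeness)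
    show "ZFC \<subseteq> ZFC_ord \<union> S5_scheme" unfolding ZFC_ord_def by blast
  next
    fix E :: "nat \<Rightarrow> nat \<Rightarrow> bool" and s
    assume M: "\<forall>\<psi>\<in>ZFC_ord \<union> S5_scheme. sat UNIV E s \<psi>"
    interpret zfc E using zfc_modelI(1)[OF M] .
    have "elementary (s 0)" using S5_imp_elementary zfc_modelI(2)[OF M] M by blast
    then show "sat UNIV E s \<psi>" using elementary_imp_correct \<psi> by blast
  qed
qed

end
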